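(* There are separable operator spaces $X$ and $Y$ such that (1) $X$ does not isomorphically embed into $Y$ (as a Banach space), and (2) $X$ spherically-completely coarsely embeds into $Y$.
   Context: An operator space is a closed linear subspace $X$ of $\mathcal{B}(H)$ for some complex Hilbert space $H$. For $n\in\mathbb{N}$, $\mathrm{M}_n(X)$ is the space of $n\times n$ matrices over $X$ with the norm inherited from $\mathrm{M}_n(\mathcal{B}(H))\cong\mathcal{B}(H^{\oplus n})$. For a (not necessarily linear) map $f\colon X\to Y$, its $n$-th amplification is $f_n\colon\mathrm{M}_n(X)\to\mathrm{M}_n(Y)$, $f_n([x_{ij}])=[f(x_{ij})]$. $\partial B_E$ denotes the unit sphere of a Banach space $E$. "Isomorphically embed" means: there is a bounded linear map $X\to Y$ that is an isomorphism onto its image. A sequence $\bar f=(F^n\colon A_n\to B_n)_n$ of maps between metric spaces $(A_n,d_n)$, $(B_n,\partial_n)$ is an equi-coarse embedding (the maps are equi-coarse embeddings) if $\omega_{\bar f}(t)<\infty$ for all $t\ge 0$ and $\lim_{t\to\infty}\rho_{\bar f}(t)=\infty$, where $\omega_{\bar f}(t)=\sup_n\sup\{\partial_n(F^n(x),F^n(y))\mid d_n(x,y)\le t\}$ and $\rho_{\bar f}(t)=\inf_n\inf\{\partial_n(F^n(x),F^n(y))\mid d_n(x,y)\ge t\}$ (with $\inf\emptyset=\infty$). A map $F\colon\mathrm{M}_n(X)\to\mathrm{M}_n(Y)$ is a spherical amplification if for all $r\ge 0$ there is a map $f\colon X\to Y$ with $F\restriction_{r\cdot\partial B_{\mathrm{M}_n(X)}}=f_n\restriction_{r\cdot\partial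 B_{\mathrm{M}_n(X)}}$. The operator space $X$ spherically-completely coarsely embeds into $Y$ if there is a sequence $(F^n\colon\mathrm{M}_n(X)\to\mathrm{M}_n(Y))_n$ of spherical amplifications which are equi-coarse embeddings. *)

theory Defs
  imports "HOL-Analysis.Analysis" "Jordan_Normal_Form.Matrix"
begin

section \<open>Complex Hilbert spaces\<close>

text \<open>
  HOL-Analysis only has real inner product spaces. A complex Hilbert space is a complete real
  inner product space with a compatible complex scalar multiplication and a sesquilinear form
  (linear in the first argument) whose real part is the real inner product; in particular
  \<open>norm x = sqrt (Re (cinner x x))\<close>.
\<close>

class complex_hilbert_space = real_inner + complete_space +
  fixes scaleC :: "complex \<Rightarrow> 'a \<Rightarrow> 'a"  (infixr \<open>*\<^sub>C\<close> 75)
    and cinner :: "'a \<Rightarrow> 'a \<Rightarrow> complex"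
  assumes scaleC_add_right: "c *\<^sub>C (x + y) = c *\<^sub>C x + c *\<^sub>C y"
    and scaleC_add_left: "(b + c) *\<^sub>C x = b *\<^sub>C x + c *\<^sub>C x"
    and scaleC_scaleC: "b *\<^sub>C c *\<^sub>C x = (b * c) *\<^sub>C x"
    and scaleR_scaleC: "r *\<^sub>R x = complex_of_real r *\<^sub>C x"
    and cinner_commute: "cinner x y = cnj (cinner y x)"
    and cinner_add_left: "cinner (x + y) z = cinner x z + cinner y z"
    and cinner_scaleC_left: "cinner (c *\<^sub>C x) y = c * cinner x y"
    and inner_eq_Re_cinner: "inner x y = Re (cinner x y)"

lemma norm_scaleC: "norm (c *\<^sub>C x) = cmod c * norm (x :: 'a::complex_hilbert_space)"
proof -
  have "cinner x x = cnj (cinner x x)" by (rule cinner_commute)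
  then have im: "Im (cinner x x) = 0" by (simp add: complex_eq_iff)
  have "cinner (c *\<^sub>C x) (c *\<^sub>C x) = c * cnj (c * cinner x x)"
    by (metis cinner_commute cinner_scaleC_left)
  also have "\<dots> = (c * cnj c) * cnj (cinner x x)" by simp
  also have "c * cnj c = complex_of_real ((cmod c)\<^sup>2)" by (simp only: complex_norm_square)
  finally have "inner (c *\<^sub>C x) (c *\<^sub>C x) = (cmod c)\<^sup>2 * inner x x"
    by (simp add: inner_eq_Re_cinner im)
  then show ?thesis
    by (simp add: norm_eq_sqrt_inner real_sqrt_mult)
qed

lemma bounded_linear_scaleC: "bounded_linear (\<lambda>x :: 'a::complex_hilbert_space. c *\<^sub>C x)"
proof (rule bounded_linear_intro[where K = "cmod c"])
  fix r and x :: 'a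
  show "c *\<^sub>C (r *\<^sub>R x) = r *\<^sub>R (c *\<^sub>C x)"
    by (simp add: scaleR_scaleC scaleC_scaleC mult.commute)
qed (simp_all add: scaleC_add_right norm_scaleC mult.commute)


section \<open>The Hilbert space of square-summable complex sequences\<close>

text \<open>
  HOL cannot quantify existentially over types, so existence statements about separable operator
  spaces are made inside \<open>B(ell2)\<close>: every separable operator space is completely isometric to a
  subspace of it.
\<close>

typedef ell2 = "{x :: nat \<Rightarrow> complex. summable (\<lambda>i. (cmod (x i))\<^sup>2)}"
  by (rule exI[of _ "\<lambda>_. 0"]) simp

setup_lifting type_definition_ell2

lemma ell2_add:
  assumes "summable (\<lambda>i. (cmod (x i))\<^sup>2)" "summable (\<lambda>i. (cmod (y i))\<^sup>2)"
  shows "summable (\<lambda>i. (cmod (x i + y i))\<^sup>2)"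
proof (rule summable_comparison_test')
  show "summable (\<lambda>i. 2 * (cmod (x i))\<^sup>2 + 2 * (cmod (y i))\<^sup>2)"
    by (intro summable_add summable_mult assms)
  fix i :: nat
  have "(cmod (x i + y i))\<^sup>2 \<le> (cmod (x i) + cmod (y i))\<^sup>2"
    by (intro power_mono norm_triangle_ineq) auto
  also have "\<dots> \<le> 2 * (cmod (x i))\<^sup>2 + 2 * (cmod (y i))\<^sup>2"
    using zero_le_power2[of "cmod (x i) - cmod (y i)"]
    by (simp add: power2_eq_square algebra_simps)
  finally show "norm ((cmod (x i + y i))\<^sup>2) \<le> 2 * (cmod (x i))\<^sup>2 + 2 * (cmod (y i))\<^sup>2"
    by simp
qed

lemma ell2_scale:
  assumes "summable (\<lambda>i. (cmod (x i))\<^sup>2)"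
  shows "summable (\<lambda>i. (cmod (c * x i))\<^sup>2)"
  using summable_mult[OF assms, of "(cmod c)\<^sup>2"] by (simp add: norm_mult power_mult_distrib)

lemma ell2_summable_cinner:
  assumes "summable (\<lambda>i. (cmod (x i))\<^sup>2)" "summable (\<lambda>i. (cmod (y i))\<^sup>2)"
  shows "summable (\<lambda>i. x i * cnj (y i))"
proof (rule summable_comparison_test')
  show "summable (\<lambda>i. (cmod (x i))\<^sup>2 + (cmod (y i))\<^sup>2)"
    by (intro summable_add assms)
  fix i :: nat
  show "norm (x i * cnj (y i)) \<le> (cmod (x i))\<^sup>2 + (cmod (y i))\<^sup>2"
    using zero_le_power2[of "cmod (x i) - cmod (y i)"] mult_nonneg_nonneg[OF norm_ge_zero norm_ge_zero, of "x i" "y i"]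
    by (simp add: norm_mult power2_eq_square algebra_simps del: mult_nonneg_nonneg)
qed

instantiation ell2 :: real_inner
begin

lift_definition zero_ell2 :: ell2 is "\<lambda>_. 0" by simp
lift_definition plus_ell2 :: "ell2 \<Rightarrow> ell2 \<Rightarrow> ell2" is "\<lambda>x y i. x i + y i" by (rule ell2_add)
lift_definition uminus_ell2 :: "ell2 \<Rightarrow> ell2" is "\<lambda>x i. - x i" by simp
lift_definition minus_ell2 :: "ell2 \<Rightarrow> ell2 \<Rightarrow> ell2" is "\<lambda>x y i. x i - y i"
  using ell2_add[of _ "\<lambda>i. - _ i"] by simp
lift_definition scaleR_ell2 :: "real \<Rightarrow> ell2 \<Rightarrow> ell2" is "\<lambda>r x i. complex_of_real r * x i"
  by (rule ell2_scale)
lift_definition inner_ell2 :: "ell2 \<Rightarrow> ell2 \<Rightarrow> real" is "\<lambda>x y. Re (\<Sum>i. x i * cnj (y i))" .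
definition norm_ell2 :: "ell2 \<Rightarrow> real" where "norm_ell2 x = sqrt (inner x x)"
definition dist_ell2 :: "ell2 \<Rightarrow> ell2 \<Rightarrow> real" where "dist_ell2 x y = norm (x - y)"
definition sgn_ell2 :: "ell2 \<Rightarrow> ell2" where "sgn_ell2 x = inverse (norm x) *\<^sub>R x"
definition uniformity_ell2 :: "(ell2 \<times> ell2) filter"
  where "uniformity_ell2 = (INF e\<in>{0<..}. principal {(x, y). dist x y < e})"
definition open_ell2 :: "ell2 set \<Rightarrow> bool"
  where "open_ell2 U \<longleftrightarrow> (\<forall>x\<in>U. eventually (\<lambda>(x', y). x' = x \<longrightarrow> y \<in> U) uniformity)"

lemma ell2_inner_self: "inner x x = (\<Sum>i. (cmod (Rep_ell2 x i))\<^sup>2)"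
proof -
  have s: "summable (\<lambda>i. (cmod (Rep_ell2 x i))\<^sup>2)" using Rep_ell2 by blast
  have "(\<Sum>i. Rep_ell2 x i * cnj (Rep_ell2 x i)) = (\<Sum>i. complex_of_real ((cmod (Rep_ell2 x i))\<^sup>2))"
    by (simp only: complex_norm_square)
  also have "\<dots> = complex_of_real (\<Sum>i. (cmod (Rep_ell2 x i))\<^sup>2)"
    using suminf_of_real[OF s, where 'a = complex] by simp
  finally show ?thesis by (simp only: inner_ell2.rep_eq Re_complex_of_real)
qed

lemma ell2_norm: "norm x = sqrt (\<Sum>i. (cmod (Rep_ell2 x i))\<^sup>2)"
  by (simp only: norm_ell2_def ell2_inner_self)

lemma ell2_partial_sum_le: "(\<Sum>i<k. (cmod (Rep_ell2 x i))\<^sup>2) \<le> (norm x)\<^sup>2"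
proof -
  have s: "summable (\<lambda>i. (cmod (Rep_ell2 x i))\<^sup>2)" using Rep_ell2 by blast
  have "0 \<le> (\<Sum>i. (cmod (Rep_ell2 x i))\<^sup>2)" by (intro suminf_nonneg s) simp
  then show ?thesis using sum_le_suminf[OF s, of "{..<k}"] by (simp add: ell2_norm)
qed

lemma ell2_coord_le: "cmod (Rep_ell2 x i) \<le> norm x"
proof -
  have s: "summable (\<lambda>i. (cmod (Rep_ell2 x i))\<^sup>2)" using Rep_ell2 by blast
  show ?thesis unfolding ell2_norm
    by (rule real_le_rsqrt) (use sum_le_suminf[OF s, of "{i}"] in simp)
qed

lemma ell2_cinner_commute:
  assumes "summable (\<lambda>i. (cmod (x i))\<^sup>2)" "summable (\<lambda>i. (cmod (y i))\<^sup>2)"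
  shows "(\<Sum>i. x i * cnj (y i)) = cnj (\<Sum>i. y i * cnj (x i))"
proof -
  have "cnj (\<Sum>i. y i * cnj (x i)) = (\<Sum>i. cnj (y i * cnj (x i)))"
    by (intro bounded_linear.suminf[OF bounded_linear_cnj] ell2_summable_cinner assms)
  then show ?thesis by (simp add: mult.commute)
qed

lemma ell2_cinner_add:
  assumes "summable (\<lambda>i. (cmod (x i))\<^sup>2)" "summable (\<lambda>i. (cmod (y i))\<^sup>2)"
    "summable (\<lambda>i. (cmod (z i))\<^sup>2)"
  shows "(\<Sum>i. (x i + y i) * cnj (z i)) = (\<Sum>i. x i * cnj (z i)) + (\<Sum>i. y i * cnj (z i))"
  by (simp add: suminf_add ell2_summable_cinner assms distrib_right)

lemma ell2_cinner_scale:
  assumes "summable (\<lambda>i. (cmod (x i))\<^sup>2)" "summable (\<lambda>i. (cmod (y i))\<^sup>2)"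
  shows "(\<Sum>i. c * x i * cnj (y i)) = c * (\<Sum>i. x i * cnj (y i))"
  using suminf_mult[OF ell2_summable_cinner[OF assms], of c] by (simp add: mult.assoc)

instance
proof (intro_classes)
  fix x y z :: ell2 and a b :: real
  show "x + y + z = x + (y + z)" by transfer (simp add: add.assoc)
  show "x + y = y + x" by transfer (simp add: add.commute)
  show "0 + x = x" by transfer simp
  show "- x + x = 0" by transfer simp
  show "x - y = x + - y" by transfer simp
  show "a *\<^sub>R (x + y) = a *\<^sub>R x + a *\<^sub>R y" by transfer (simp add: algebra_simps)
  show "(a + b) *\<^sub>R x = a *\<^sub>R x + b *\<^sub>R x" by transfer (simp add: algebra_simps)
  show "a *\<^sub>R b *\<^sub>R x = (a * b) *\<^sub>R x" by transfer (simp add: algebra_simps)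
  show "1 *\<^sub>R x = x" by transfer simp
  show "sgn x = inverse (norm x) *\<^sub>R x" by (rule sgn_ell2_def)
  show "dist x y = norm (x - y)" by (rule dist_ell2_def)
  show "uniformity = (INF e\<in>{0<..}. principal {(x, y :: ell2). dist x y < e})"
    by (rule uniformity_ell2_def)
  show "open U = (\<forall>x\<in>U. \<forall>\<^sub>F (x', y) in uniformity. x' = x \<longrightarrow> y \<in> U)" for U :: "ell2 set"
    by (rule open_ell2_def)
  show "inner x y = inner y x" by transfer (subst ell2_cinner_commute, simp_all)
  show "inner (x + y) z = inner x z + inner y z" by transfer (simp add: ell2_cinner_add)
  show "inner (a *\<^sub>R x) y = a * inner x y" by transfer (simp add: ell2_cinner_scale)
  have s: "summable (\<lambda>i. (cmod (Rep_ell2 x i))\<^sup>2)" using Rep_ell2 by blast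
  show "0 \<le> inner x x" unfolding ell2_inner_self by (intro suminf_nonneg s) simp
  show "inner x x = 0 \<longleftrightarrow> x = 0"
    unfolding ell2_inner_self suminf_eq_zero_iff[OF s zero_le_power2]
    by transfer (auto simp: fun_eq_iff)
  show "norm x = sqrt (inner x x)" by (rule norm_ell2_def)
qed

end

instance ell2 :: complete_space
proof
  fix X :: "nat \<Rightarrow> ell2"
  assume "Cauchy X"
  then have X: "\<forall>e>0. \<exists>M. \<forall>m\<ge>M. \<forall>n\<ge>M. dist (X m) (X n) < e"
    by (simp only: Cauchy_def)
  have coord: "cmod (Rep_ell2 (X m) i - Rep_ell2 (X n) i) \<le> dist (X m) (X n)" for m n i
    using ell2_coord_le[of "X m - X n" i] by (simp add: dist_ell2_def minus_ell2.rep_eq)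
  have "Cauchy (\<lambda>n. Rep_ell2 (X n) i)" for i
    unfolding Cauchy_def dist_norm
  proof (intro allI impI)
    fix e :: real assume "e > 0"
    then obtain M where "\<forall>m\<ge>M. \<forall>n\<ge>M. dist (X m) (X n) < e" using X[rule_format] by blast
    then show "\<exists>M. \<forall>m\<ge>M. \<forall>n\<ge>M. norm (Rep_ell2 (X m) i - Rep_ell2 (X n) i) < e"
      using le_less_trans[OF coord] by blast
  qed
  then have "\<forall>i. \<exists>a. (\<lambda>n. Rep_ell2 (X n) i) \<longlonglongrightarrow> a"
    using Cauchy_convergent convergent_def by blast
  then obtain a where a: "\<And>i. (\<lambda>n. Rep_ell2 (X n) i) \<longlonglongrightarrow> a i" by metis
  have tail: "summable (\<lambda>i. (cmod (Rep_ell2 (X m) i - a i))\<^sup>2)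
      \<and> (\<Sum>i. (cmod (Rep_ell2 (X m) i - a i))\<^sup>2) \<le> e\<^sup>2"
    if "e > 0" and M: "\<forall>n\<ge>M. dist (X m) (X n) < e" for e m M
  proof -
    have part: "(\<Sum>i<k. (cmod (Rep_ell2 (X m) i - a i))\<^sup>2) \<le> e\<^sup>2" for k
    proof (rule LIMSEQ_le_const2)
      show "(\<lambda>n. \<Sum>i<k. (cmod (Rep_ell2 (X m) i - Rep_ell2 (X n) i))\<^sup>2)
          \<longlonglongrightarrow> (\<Sum>i<k. (cmod (Rep_ell2 (X m) i - a i))\<^sup>2)"
        by (intro tendsto_intros a)
      have "(\<Sum>i<k. (cmod (Rep_ell2 (X m) i - Rep_ell2 (X n) i))\<^sup>2) \<le> e\<^sup>2" if "n \<ge> M" for n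
      proof -
        have "(\<Sum>i<k. (cmod (Rep_ell2 (X m) i - Rep_ell2 (X n) i))\<^sup>2) \<le> (norm (X m - X n))\<^sup>2"
          using ell2_partial_sum_le[where x = "X m - X n" and k = k]
          by (simp add: minus_ell2.rep_eq)
        also have "\<dots> \<le> e\<^sup>2"
        proof (rule power_mono)
          show "norm (X m - X n) \<le> e"
            using M that unfolding dist_ell2_def by (blast intro: less_imp_le)
        qed simp
        finally show ?thesis .
      qed
      then show "\<exists>N. \<forall>n\<ge>N. (\<Sum>i<k. (cmod (Rep_ell2 (X m) i - Rep_ell2 (X n) i))\<^sup>2) \<le> e\<^sup>2"
        by blast
    qed
    have s: "summable (\<lambda>i. (cmod (Rep_ell2 (X m) i - a i))\<^sup>2)"
      by (rule summableI_nonneg_bounded[OF _ part]) simp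
    show ?thesis by (intro conjI s suminf_le_const[OF s part])
  qed
  have pos: "(0::real) < 1" by simp
  obtain M1 where "\<forall>m\<ge>M1. \<forall>n\<ge>M1. dist (X m) (X n) < 1"
    using X[rule_format, OF pos] ..
  then have M1: "\<forall>n\<ge>M1. dist (X M1) (X n) < 1" by simp
  have "summable (\<lambda>i. (cmod (Rep_ell2 (X M1) i + (- 1) * (Rep_ell2 (X M1) i - a i)))\<^sup>2)"
    by (rule ell2_add[OF _ ell2_scale]) (use Rep_ell2[of "X M1"] tail[OF pos M1] in simp_all)
  then have "summable (\<lambda>i. (cmod (a i))\<^sup>2)" by simp
  then have Rep: "Rep_ell2 (Abs_ell2 a) = a" by (simp add: Abs_ell2_inverse)
  have "\<exists>l. \<forall>e>0. \<exists>N. \<forall>n\<ge>N. dist (X n) l < e"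
  proof (intro exI[of _ "Abs_ell2 a"] allI impI)
    fix e :: real assume "e > 0"
    then obtain N where N: "\<forall>m\<ge>N. \<forall>n\<ge>N. dist (X m) (X n) < e / 2"
      using X[rule_format, OF half_gt_zero] by blast
    have "dist (X n) (Abs_ell2 a) < e" if "n \<ge> N" for n
    proof -
      have "(\<Sum>i. (cmod (Rep_ell2 (X n) i - a i))\<^sup>2) \<le> (e / 2)\<^sup>2"
        using tail[of "e / 2" N n] N that \<open>e > 0\<close> by simp
      then have "sqrt (\<Sum>i. (cmod (Rep_ell2 (X n) i - a i))\<^sup>2) \<le> e / 2"
        using \<open>e > 0\<close> by (intro real_le_lsqrt) auto
      then have "dist (X n) (Abs_ell2 a) \<le> e / 2"
        by (simp only: dist_ell2_def ell2_norm minus_ell2.rep_eq Rep)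
      then show ?thesis using \<open>e > 0\<close> by simp
    qed
    then show "\<exists>N. \<forall>n\<ge>N. dist (X n) (Abs_ell2 a) < e" by blast
  qed
  then show "convergent X" by (simp add: convergent_def lim_sequentially)
qed

instantiation ell2 :: complex_hilbert_space
begin

lift_definition scaleC_ell2 :: "complex \<Rightarrow> ell2 \<Rightarrow> ell2" is "\<lambda>c x i. c * x i" by (rule ell2_scale)
lift_definition cinner_ell2 :: "ell2 \<Rightarrow> ell2 \<Rightarrow> complex" is "\<lambda>x y. \<Sum>i. x i * cnj (y i)" .

instance
proof
  fix x y z :: ell2 and b c :: complex and r :: real
  show "c *\<^sub>C (x + y) = c *\<^sub>C x + c *\<^sub>C y" by transfer (simp add: algebra_simps)
  show "(b + c) *\<^sub>C x = b *\<^sub>C x + c *\<^sub>C x" by transfer (simp add: algebra_simps)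
  show "b *\<^sub>C c *\<^sub>C x = (b * c) *\<^sub>C x" by transfer (simp add: algebra_simps)
  show "r *\<^sub>R x = complex_of_real r *\<^sub>C x" by transfer simp
  show "cinner x y = cnj (cinner y x)" by transfer (rule ell2_cinner_commute)
  show "cinner (x + y) z = cinner x z + cinner y z" by transfer (rule ell2_cinner_add)
  show "cinner (c *\<^sub>C x) y = c * cinner x y" by transfer (rule ell2_cinner_scale)
  show "inner x y = Re (cinner x y)" by transfer simp
qed

end


section \<open>Operator spaces\<close>

text \<open>
  The type \<open>'h \<Rightarrow>\<^sub>L 'h\<close> consists of the bounded real-linear operators, with the operator norm;
  \<open>B(H)\<close> is its subset of complex-linear operators.
\<close>

definition complex_operators :: "('h::complex_hilbert_space \<Rightarrow>\<^sub>L 'h) set" where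
  "complex_operators =
     {A. \<forall>c x. blinfun_apply A (c *\<^sub>C x) = c *\<^sub>C blinfun_apply A x}"

lift_definition scale_op ::
  "complex \<Rightarrow> ('h::complex_hilbert_space \<Rightarrow>\<^sub>L 'h) \<Rightarrow> ('h \<Rightarrow>\<^sub>L 'h)" is "\<lambda>c A x. c *\<^sub>C A x"
  by (rule bounded_linear_compose[OF bounded_linear_scaleC])

definition operator_space :: "('h::complex_hilbert_space \<Rightarrow>\<^sub>L 'h) set \<Rightarrow> bool" where
  "operator_space X \<longleftrightarrow>
     X \<subseteq> complex_operators \<and>
     0 \<in> X \<and> (\<forall>A\<in>X. \<forall>B\<in>X. A + B \<in> X) \<and> (\<forall>c. \<forall>A\<in>X. scale_op c A \<in> X) \<and>
     closed X"

definition separable_operator_space :: "('h::complex_hilbert_space \<Rightarrow>\<^sub>L 'h) set \<Rightarrow> bool" where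
  "separable_operator_space X \<longleftrightarrow> operator_space X \<and> separable_space (top_of_set X)"

definition bounded_clinear_on ::
  "('h::complex_hilbert_space \<Rightarrow>\<^sub>L 'h) set \<Rightarrow>
   (('h \<Rightarrow>\<^sub>L 'h) \<Rightarrow> ('k::complex_hilbert_space \<Rightarrow>\<^sub>L 'k)) \<Rightarrow> bool" where
  "bounded_clinear_on X T \<longleftrightarrow>
     (\<forall>A\<in>X. \<forall>B\<in>X. T (A + B) = T A + T B) \<and>
     (\<forall>c. \<forall>A\<in>X. T (scale_op c A) = scale_op c (T A)) \<and>
     (\<exists>K. \<forall>A\<in>X. norm (T A) \<le> K * norm A)"

definition isomorphically_embeds ::
  "('h::complex_hilbert_space \<Rightarrow>\<^sub>L 'h) set \<Rightarrow> ('k::complex_hilbert_space \<Rightarrow>\<^sub>L 'k) set \<Rightarrow> bool" where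
  "isomorphically_embeds X Y \<longleftrightarrow>
     (\<exists>T. T \<in> X \<rightarrow> Y \<and> bounded_clinear_on X T \<and>
          inj_on T X \<and> bounded_clinear_on (T ` X) (inv_into X T))"


section \<open>Matrices over an operator space\<close>

definition matrices_over :: "nat \<Rightarrow> 'a set \<Rightarrow> 'a mat set" where
  "matrices_over n X = {A \<in> carrier_mat n n. elements_mat A \<subseteq> X}"

text \<open>
  The operator norm of \<open>A\<close> acting by matrix multiplication on column vectors \<open>\<xi>\<close> in the Hilbert
  space direct sum of \<open>n\<close> copies of \<open>H\<close>; only the entries of \<open>\<xi>\<close> below \<open>n\<close> matter.
\<close>

definition matrix_norm :: "('h::complex_hilbert_space \<Rightarrow>\<^sub>L 'h) mat \<Rightarrow> real" where
  "matrix_norm A =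
     (SUP \<xi> \<in> {\<xi> :: nat \<Rightarrow> 'h. L2_set (\<lambda>j. norm (\<xi> j)) {..<dim_col A} \<le> 1}.
        L2_set (\<lambda>i. norm (\<Sum>j<dim_col A. blinfun_apply (A $$ (i, j)) (\<xi> j))) {..<dim_row A})"

lemma matrix_norm_bdd_above:
  fixes A :: "('h::complex_hilbert_space \<Rightarrow>\<^sub>L 'h) mat"
  shows "bdd_above
    ((\<lambda>\<xi>. L2_set (\<lambda>i. norm (\<Sum>j<dim_col A. blinfun_apply (A $$ (i, j)) (\<xi> j))) {..<dim_row A})
      ` {\<xi> :: nat \<Rightarrow> 'h. L2_set (\<lambda>j. norm (\<xi> j)) {..<dim_col A} \<le> 1})"
proof (rule bdd_aboveI2)
  fix \<xi> :: "nat \<Rightarrow> 'h"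
  assume "\<xi> \<in> {\<xi>. L2_set (\<lambda>j. norm (\<xi> j)) {..<dim_col A} \<le> 1}"
  then have le1: "norm (\<xi> j) \<le> 1" if "j < dim_col A" for j
    using member_le_L2_set[of "{..<dim_col A}" j "\<lambda>j. norm (\<xi> j)"] that by simp
  have "norm (\<Sum>j<dim_col A. blinfun_apply (A $$ (i, j)) (\<xi> j))
      \<le> (\<Sum>j<dim_col A. norm (A $$ (i, j)))" for i
    by (rule sum_norm_le)
      (use le1 in \<open>fastforce intro: order_trans[OF norm_blinfun] mult_left_le\<close>)
  then show "L2_set (\<lambda>i. norm (\<Sum>j<dim_col A. blinfun_apply (A $$ (i, j)) (\<xi> j))) {..<dim_row A}
      \<le> (\<Sum>i<dim_row A. \<Sum>j<dim_col A. norm (A $$ (i, j)))"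
    by (intro order_trans[OF L2_set_le_sum] sum_mono) auto
qed

definition matrix_dist ::
  "('h::complex_hilbert_space \<Rightarrow>\<^sub>L 'h) mat \<Rightarrow> ('h \<Rightarrow>\<^sub>L 'h) mat \<Rightarrow> real" where
  "matrix_dist A B = matrix_norm (A - B)"


section \<open>Equi-coarse embeddings\<close>

text \<open>
  Sequences are indexed by \<open>n \<ge> 1\<close>; \<open>A n\<close>, with metric \<open>d n\<close>, is the domain of \<open>F n\<close>, and \<open>e n\<close> is
  the metric on its codomain. In \<open>ereal\<close>, the infimum over the empty set is \<open>\<infinity>\<close>.
\<close>

definition equi_omega ::
  "(nat \<Rightarrow> 'a set) \<Rightarrow> (nat \<Rightarrow> 'a \<Rightarrow> 'a \<Rightarrow> real) \<Rightarrow> (nat \<Rightarrow> 'b \<Rightarrow> 'b \<Rightarrow> real) \<Rightarrow>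
   (nat \<Rightarrow> 'a \<Rightarrow> 'b) \<Rightarrow> real \<Rightarrow> ereal" where
  "equi_omega A d e F t =
     (SUP n\<in>{1..}. SUP (x, y)\<in>{(x, y). x \<in> A n \<and> y \<in> A n \<and> d n x y \<le> t}.
        ereal (e n (F n x) (F n y)))"

definition equi_rho ::
  "(nat \<Rightarrow> 'a set) \<Rightarrow> (nat \<Rightarrow> 'a \<Rightarrow> 'a \<Rightarrow> real) \<Rightarrow> (nat \<Rightarrow> 'b \<Rightarrow> 'b \<Rightarrow> real) \<Rightarrow>
   (nat \<Rightarrow> 'a \<Rightarrow> 'b) \<Rightarrow> real \<Rightarrow> ereal" where
  "equi_rho A d e F t =
     (INF n\<in>{1..}. INF (x, y)\<in>{(x, y). x \<in> A n \<and> y \<in> A n \<and> d n x y \<ge> t}.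
        ereal (e n (F n x) (F n y)))"

definition equi_coarse_embedding ::
  "(nat \<Rightarrow> 'a set) \<Rightarrow> (nat \<Rightarrow> 'a \<Rightarrow> 'a \<Rightarrow> real) \<Rightarrow> (nat \<Rightarrow> 'b \<Rightarrow> 'b \<Rightarrow> real) \<Rightarrow>
   (nat \<Rightarrow> 'a \<Rightarrow> 'b) \<Rightarrow> bool" where
  "equi_coarse_embedding A d e F \<longleftrightarrow>
     (\<forall>t\<ge>0. equi_omega A d e F t < \<infinity>) \<and> (equi_rho A d e F \<longlongrightarrow> \<infinity>) at_top"


section \<open>Spherically-complete coarse embeddings\<close>

text \<open>The \<open>n\<close>-th amplification of \<open>f\<close> is \<^const>\<open>map_mat\<close> \<open>f\<close>.\<close>

definition spherical_amplification ::
  "nat \<Rightarrow> ('h::complex_hilbert_space \<Rightarrow>\<^sub>L 'h) set \<Rightarrow> ('k::complex_hilbert_space \<Rightarrow>\<^sub>L 'k) set \<Rightarrow>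
   (('h \<Rightarrow>\<^sub>L 'h) mat \<Rightarrow> ('k \<Rightarrow>\<^sub>L 'k) mat) \<Rightarrow> bool" where
  "spherical_amplification n X Y F \<longleftrightarrow>
     F \<in> matrices_over n X \<rightarrow> matrices_over n Y \<and>
     (\<forall>r\<ge>0. \<exists>f. f \<in> X \<rightarrow> Y \<and>
        (\<forall>A\<in>matrices_over n X. matrix_norm A = r \<longrightarrow> F A = map_mat f A))"

definition spherically_completely_coarsely_embeds ::
  "('h::complex_hilbert_space \<Rightarrow>\<^sub>L 'h) set \<Rightarrow> ('k::complex_hilbert_space \<Rightarrow>\<^sub>L 'k) set \<Rightarrow> bool" where
  "spherically_completely_coarsely_embeds X Y \<longleftrightarrow>
     (\<exists>F. (\<forall>n\<ge>1. spherical_amplification n X Y (F n)) \<and>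
          equi_coarse_embedding (\<lambda>n. matrices_over n X)
            (\<lambda>_. matrix_dist) (\<lambda>_. matrix_dist) F)"

end

theory Submission
  imports Defs
begin

text \<open>
  The first space is \<open>c\<^sub>0\<close>. Every separable Banach space, in particular \<open>c\<^sub>0\<close>, is a quotient of
  \<open>\<ell>\<^sub>1\<close>; let \<open>Q\<close> be such a quotient map. It has no bounded linear right inverse, but it has a
  non-linear one, \<open>f\<close>, with \<open>\<parallel>f x\<parallel>\<^sub>1\<close> bounded by a multiple of \<open>\<parallel>x\<parallel>\<close>. Under the equivalent norm
  \<open>max \<parallel>Q y\<parallel> (\<epsilon> * \<parallel>y\<parallel>\<^sub>1)\<close> on \<open>\<ell>\<^sub>1\<close> the defect \<open>f x + f y - f (x + y)\<close>, which lies in the kernel of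
  \<open>Q\<close>, has size of order \<open>\<epsilon> * (\<parallel>x\<parallel> + \<parallel>y\<parallel>)\<close>: on a ball that is not too large, \<open>f\<close> is linear and
  isometric up to a small error. The second space is, up to an equivalent norm, the \<open>\<ell>\<^sub>1\<close>-sum of these
  renormings for \<open>\<epsilon> = 2 powr (- k)\<close>.

  An operator from \<open>c\<^sub>0\<close> to a space isomorphic to \<open>\<ell>\<^sub>1\<close>, or to an \<open>\<ell>\<^sub>1\<close>-sum of such spaces, sends the unit
  vectors to a null sequence; this is a gliding hump argument carried out first within a summand and
  then across the summands (lemmas \<open>gliding_hump\<close> and \<open>c0_to_l1_sum_null\<close>). Hence \<open>c\<^sub>0\<close> does
  not embed.

  Both spaces carry their minimal operator space structure, realised by diagonal operators on
  \<open>\<ell>\<^sub>2\<close>: the norm of a matrix is the supremum, over a countable norming set of functionals, of the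
  norms of the scalar matrices obtained by applying a functional to the entries (lemma
  \<open>matrix_norm_le_iff\<close>). The amplification of a map that agrees with a linear isometry up to an entrywise
  error of order \<open>1 / n\<close> therefore changes distances of \<open>n \<times> n\<close> matrices by a bounded amount only.
  The map may depend on \<open>n\<close> and on the norm \<open>r\<close> of the matrix, so \<open>\<epsilon>\<close> can be chosen small enough to
  achieve this error. When \<open>r\<close> grows the construction must move on to summands with smaller \<open>\<epsilon>\<close>; it
  does so gradually, by a partition of unity on the logarithmic scale (lemma
  \<open>radial_weight_variation\<close>), so that matrices with close norms keep close images. Conversely, adding up
  the quotient maps of all summands recovers the matrix from its image
  (lemma \<open>dist_le_amplification_dist\<close>).

  The quotient map and its right inverse are made explicit: the basis of \<open>\<ell>\<^sub>1\<close> is indexed by the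
  finite subsets of the natural numbers, \<open>Q\<close> sends a set to its indicator function, and the right
  inverse decomposes a null sequence into its superlevel sets.
\<close>

section \<open>Diagonal operators\<close>

lift_definition unit_seq :: "nat \<Rightarrow> ell2" is "\<lambda>i j. if j = i then 1 else 0"
proof -
  fix i :: nat
  show "summable (\<lambda>j. (cmod (if j = i then 1 else 0))\<^sup>2)"
    by (rule summable_finite[of "{i}"]) auto
qed

lemma norm_unit_seq [simp]: "norm (unit_seq i) = 1"
proof -
  have "(\<Sum>j. (cmod (Rep_ell2 (unit_seq i) j))\<^sup>2) = (\<Sum>j\<in>{i}. (cmod (Rep_ell2 (unit_seq i) j))\<^sup>2)"
    by (rule suminf_finite) (auto simp: unit_seq.rep_eq)
  then show ?thesis by (simp add: ell2_norm unit_seq.rep_eq)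
qed

lemma Rep_ell2_sum: "Rep_ell2 (\<Sum>j\<in>I. x j) t = (\<Sum>j\<in>I. Rep_ell2 (x j) t)"
  by (induction I rule: infinite_finite_induct) (auto simp: zero_ell2.rep_eq plus_ell2.rep_eq)

lemma summable_Rep_ell2: "summable (\<lambda>i. (cmod (Rep_ell2 x i))\<^sup>2)"
  using Rep_ell2 by blast

lemma ell2_norm_sq: "(norm x)\<^sup>2 = (\<Sum>i. (cmod (Rep_ell2 x i))\<^sup>2)"
  by (simp add: ell2_norm suminf_nonneg[OF summable_Rep_ell2])

definition diag_entry :: "(ell2 \<Rightarrow>\<^sub>L ell2) \<Rightarrow> nat \<Rightarrow> complex" where
  "diag_entry A t = Rep_ell2 (blinfun_apply A (unit_seq t)) t"

text \<open>
  For a commutative operator algebra the matrix norms are computed pointwise, so both spaces are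
  realised inside the diagonal operators, where an operator is the same as its bounded sequence of
  diagonal entries.
\<close>

definition is_diag :: "(ell2 \<Rightarrow>\<^sub>L ell2) \<Rightarrow> bool" where
  "is_diag A \<longleftrightarrow> (\<forall>x t. Rep_ell2 (blinfun_apply A x) t = diag_entry A t * Rep_ell2 x t)"

lemma diag_entry_0 [simp]: "diag_entry 0 t = 0"
  by (simp add: diag_entry_def zero_ell2.rep_eq)

lemma diag_entry_add: "diag_entry (A + B) t = diag_entry A t + diag_entry B t"
  by (simp add: diag_entry_def plus_blinfun.rep_eq plus_ell2.rep_eq)

lemma diag_entry_diff: "diag_entry (A - B) t = diag_entry A t - diag_entry B t"
  by (simp add: diag_entry_def minus_blinfun.rep_eq minus_ell2.rep_eq)

lemma diag_entry_scale: "diag_entry (scale_op c A) t = c * diag_entry A t"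
  by (simp add: diag_entry_def scale_op.rep_eq scaleC_ell2.rep_eq)

lemma diag_entry_sum: "diag_entry (\<Sum>i\<in>I. A i) t = (\<Sum>i\<in>I. diag_entry (A i) t)"
  by (induction I rule: infinite_finite_induct) (auto simp: diag_entry_add)

lemma cmod_diag_entry_le: "cmod (diag_entry A t) \<le> norm A"
  using ell2_coord_le[of "blinfun_apply A (unit_seq t)" t] norm_blinfun[of A "unit_seq t"]
  by (simp add: diag_entry_def)

lemma bounded_linear_Rep_ell2: "bounded_linear (\<lambda>x. Rep_ell2 x t)"
  by (rule bounded_linear_intro[where K = 1])
    (auto simp: plus_ell2.rep_eq scaleR_ell2.rep_eq ell2_coord_le scaleR_conv_of_real)

lemma continuous_on_entry: "continuous_on S (\<lambda>A. Rep_ell2 (blinfun_apply A x) t)"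
  by (intro linear_continuous_on bounded_linear_compose[OF bounded_linear_Rep_ell2]
      bounded_linear_blinfun_apply bounded_linear_intros)

lemma continuous_on_diag_entry: "continuous_on S (\<lambda>A. diag_entry A t)"
  unfolding diag_entry_def by (rule continuous_on_entry)

lemma closed_is_diag: "closed {A. is_diag A}"
proof -
  have "{A. is_diag A} =
      (\<Inter>x. \<Inter>t. {A. Rep_ell2 (blinfun_apply A x) t = diag_entry A t * Rep_ell2 x t})"
    by (auto simp: is_diag_def)
  also have "closed \<dots>"
    by (intro closed_INT ballI closed_Collect_eq continuous_on_entry continuous_on_mult
        continuous_on_diag_entry continuous_on_const)
  finally show ?thesis .
qed

lemma is_diag_0: "is_diag 0"
  by (simp add: is_diag_def zero_ell2.rep_eq)

lemma is_diag_add: "is_diag A \<Longrightarrow> is_diag B \<Longrightarrow> is_diag (A + B)"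
  by (simp add: is_diag_def diag_entry_add plus_blinfun.rep_eq plus_ell2.rep_eq algebra_simps)

lemma is_diag_diff: "is_diag A \<Longrightarrow> is_diag B \<Longrightarrow> is_diag (A - B)"
  by (simp add: is_diag_def diag_entry_diff minus_blinfun.rep_eq minus_ell2.rep_eq algebra_simps)

lemma is_diag_scale: "is_diag A \<Longrightarrow> is_diag (scale_op c A)"
  by (simp add: is_diag_def diag_entry_scale scale_op.rep_eq scaleC_ell2.rep_eq)

lemma is_diag_complex_operator: "is_diag A \<Longrightarrow> A \<in> complex_operators"
  by (simp add: is_diag_def complex_operators_def Rep_ell2_inject[symmetric] fun_eq_iff
      scaleC_ell2.rep_eq)

lemma summable_mult_bounded:
  fixes a :: "nat \<Rightarrow> complex"
  assumes "\<And>t. cmod (a t) \<le> c"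
  shows "summable (\<lambda>t. (cmod (a t * Rep_ell2 x t))\<^sup>2)"
proof (rule summable_comparison_test')
  show "summable (\<lambda>t. c\<^sup>2 * (cmod (Rep_ell2 x t))\<^sup>2)"
    by (intro summable_mult summable_Rep_ell2)
  show "norm ((cmod (a t * Rep_ell2 x t))\<^sup>2) \<le> c\<^sup>2 * (cmod (Rep_ell2 x t))\<^sup>2" for t
    using assms[of t] by (simp add: norm_mult power_mult_distrib mult_right_mono power_mono)
qed

definition diag_op :: "(nat \<Rightarrow> complex) \<Rightarrow> ell2 \<Rightarrow>\<^sub>L ell2" where
  "diag_op a = Blinfun (\<lambda>x. Abs_ell2 (\<lambda>t. a t * Rep_ell2 x t))"

lemma Rep_diag_op:
  assumes "\<And>t. cmod (a t) \<le> c"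
  shows "Rep_ell2 (blinfun_apply (diag_op a) x) t = a t * Rep_ell2 x t"
proof -
  define f where "f = (\<lambda>x. Abs_ell2 (\<lambda>t. a t * Rep_ell2 x t))"
  have Rep: "Rep_ell2 (f x) = (\<lambda>t. a t * Rep_ell2 x t)" for x
    using summable_mult_bounded[OF assms, where x = x] by (simp add: f_def Abs_ell2_inverse)
  have "bounded_linear f"
  proof (rule bounded_linear_intro[where K = "\<bar>c\<bar>"])
    show "f (x + y) = f x + f y" for x y
      by (simp add: Rep_ell2_inject[symmetric] fun_eq_iff Rep plus_ell2.rep_eq algebra_simps)
    show "f (r *\<^sub>R x) = r *\<^sub>R f x" for r x
      by (simp add: Rep_ell2_inject[symmetric] fun_eq_iff Rep scaleR_ell2.rep_eq)
    show "norm (f x) \<le> norm x * \<bar>c\<bar>" for x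
    proof (rule power2_le_imp_le)
      have "(norm (f x))\<^sup>2 = (\<Sum>t. (cmod (a t * Rep_ell2 x t))\<^sup>2)"
        by (simp add: ell2_norm_sq Rep)
      also have "\<dots> \<le> (\<Sum>t. c\<^sup>2 * (cmod (Rep_ell2 x t))\<^sup>2)"
      proof (rule suminf_le)
        show "summable (\<lambda>t. c\<^sup>2 * (cmod (Rep_ell2 x t))\<^sup>2)"
          by (intro summable_mult summable_Rep_ell2)
        show "(cmod (a t * Rep_ell2 x t))\<^sup>2 \<le> c\<^sup>2 * (cmod (Rep_ell2 x t))\<^sup>2" for t
          using assms[of t] by (simp add: norm_mult power_mult_distrib mult_right_mono power_mono)
      qed (rule summable_mult_bounded[OF assms])
      also have "\<dots> = c\<^sup>2 * (norm x)\<^sup>2"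
        by (simp add: ell2_norm_sq suminf_mult[OF summable_Rep_ell2])
      finally show "(norm (f x))\<^sup>2 \<le> (norm x * \<bar>c\<bar>)\<^sup>2" by (simp add: power_mult_distrib mult.commute)
    qed simp
  qed
  then show ?thesis by (simp add: diag_op_def f_def[symmetric] bounded_linear_Blinfun_apply Rep)
qed

lemma diag_entry_diag_op:
  assumes "\<And>t. cmod (a t) \<le> c"
  shows "diag_entry (diag_op a) t = a t"
  by (simp add: diag_entry_def Rep_diag_op[OF assms] unit_seq.rep_eq)

lemma is_diag_diag_op:
  assumes "\<And>t. cmod (a t) \<le> c"
  shows "is_diag (diag_op a)"
  by (simp add: is_diag_def diag_entry_diag_op[OF assms] Rep_diag_op[OF assms])

lemma norm_diag_le:
  assumes "is_diag A" "\<And>t. cmod (diag_entry A t) \<le> c"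
  shows "norm A \<le> c"
proof (rule norm_blinfun_bound)
  show c: "0 \<le> c" using assms(2)[of 0] norm_ge_zero order_trans by blast
  fix x
  show "norm (blinfun_apply A x) \<le> c * norm x"
  proof (rule power2_le_imp_le)
    have "(norm (blinfun_apply A x))\<^sup>2 = (\<Sum>t. (cmod (diag_entry A t * Rep_ell2 x t))\<^sup>2)"
      using assms(1) by (simp add: ell2_norm_sq is_diag_def)
    also have "\<dots> \<le> (\<Sum>t. c\<^sup>2 * (cmod (Rep_ell2 x t))\<^sup>2)"
    proof (rule suminf_le)
      show "summable (\<lambda>t. c\<^sup>2 * (cmod (Rep_ell2 x t))\<^sup>2)"
        by (intro summable_mult summable_Rep_ell2)
      show "(cmod (diag_entry A t * Rep_ell2 x t))\<^sup>2 \<le> c\<^sup>2 * (cmod (Rep_ell2 x t))\<^sup>2" for t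
        using assms(2)[of t]
        by (simp add: norm_mult power_mult_distrib mult_right_mono power_mono)
    qed (rule summable_mult_bounded[OF assms(2)])
    also have "\<dots> = c\<^sup>2 * (norm x)\<^sup>2"
      by (simp add: ell2_norm_sq suminf_mult[OF summable_Rep_ell2])
    finally show "(norm (blinfun_apply A x))\<^sup>2 \<le> (c * norm x)\<^sup>2"
      by (simp add: power_mult_distrib)
  qed (use c in simp)
qed


section \<open>Matrices of diagonal operators\<close>

text \<open>
  The statement that the \<open>n \<times> n\<close> scalar matrix \<open>a\<close> has operator norm at most \<open>c\<close>. Stating bounds
  rather than taking a supremum makes the triangle inequality and the passage to the coordinates
  of a diagonal operator a matter of rules.
\<close>

definition mat_bound :: "nat \<Rightarrow> (nat \<Rightarrow> nat \<Rightarrow> complex) \<Rightarrow> real \<Rightarrow> bool" where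
  "mat_bound n a c \<longleftrightarrow> (\<forall>v. L2_set (\<lambda>i. cmod (\<Sum>j<n. a i j * v j)) {..<n}
     \<le> c * L2_set (\<lambda>j. cmod (v j)) {..<n})"

lemma mat_boundD:
  "mat_bound n a c \<Longrightarrow>
    L2_set (\<lambda>i. cmod (\<Sum>j<n. a i j * v j)) {..<n} \<le> c * L2_set (\<lambda>j. cmod (v j)) {..<n}"
  by (simp add: mat_bound_def)

lemma mat_bound_mono: "mat_bound n a c \<Longrightarrow> c \<le> d \<Longrightarrow> mat_bound n a d"
  unfolding mat_bound_def by (meson L2_set_nonneg mult_right_mono order_trans)

lemma mat_bound_cong:
  "mat_bound n a c \<Longrightarrow> (\<And>i j. i < n \<Longrightarrow> j < n \<Longrightarrow> b i j = a i j) \<Longrightarrow> mat_bound n b c"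
proof -
  assume a: "mat_bound n a c" and b: "\<And>i j. i < n \<Longrightarrow> j < n \<Longrightarrow> b i j = a i j"
  have "L2_set (\<lambda>i. cmod (\<Sum>j<n. b i j * v j)) {..<n}
      = L2_set (\<lambda>i. cmod (\<Sum>j<n. a i j * v j)) {..<n}" for v
    by (intro L2_set_cong refl) (simp add: b)
  with a show ?thesis by (simp add: mat_bound_def)
qed

lemma mat_bound_add:
  assumes "mat_bound n a c" "mat_bound n b d"
  shows "mat_bound n (\<lambda>i j. a i j + b i j) (c + d)"
  unfolding mat_bound_def
proof
  fix v :: "nat \<Rightarrow> complex"
  have "L2_set (\<lambda>i. cmod (\<Sum>j<n. (a i j + b i j) * v j)) {..<n}
      \<le> L2_set (\<lambda>i. cmod (\<Sum>j<n. a i j * v j) + cmod (\<Sum>j<n. b i j * v j)) {..<n}"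
    by (intro L2_set_mono) (simp_all add: distrib_right sum.distrib norm_triangle_ineq)
  also have "\<dots> \<le> L2_set (\<lambda>i. cmod (\<Sum>j<n. a i j * v j)) {..<n}
      + L2_set (\<lambda>i. cmod (\<Sum>j<n. b i j * v j)) {..<n}"
    by (rule L2_set_triangle_ineq)
  also have "\<dots> \<le> c * L2_set (\<lambda>j. cmod (v j)) {..<n} + d * L2_set (\<lambda>j. cmod (v j)) {..<n}"
    by (intro add_mono mat_boundD assms)
  finally show "L2_set (\<lambda>i. cmod (\<Sum>j<n. (a i j + b i j) * v j)) {..<n}
      \<le> (c + d) * L2_set (\<lambda>j. cmod (v j)) {..<n}" by (simp add: distrib_right)
qed

lemma mat_bound_scale:
  assumes "mat_bound n a c"
  shows "mat_bound n (\<lambda>i j. z * a i j) (cmod z * c)"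
  unfolding mat_bound_def
proof
  fix v :: "nat \<Rightarrow> complex"
  have "L2_set (\<lambda>i. cmod (\<Sum>j<n. (z * a i j) * v j)) {..<n}
      = L2_set (\<lambda>i. cmod z * cmod (\<Sum>j<n. a i j * v j)) {..<n}"
    by (simp add: mult.assoc sum_distrib_left[symmetric] norm_mult)
  also have "\<dots> = cmod z * L2_set (\<lambda>i. cmod (\<Sum>j<n. a i j * v j)) {..<n}"
    by (simp add: L2_set_right_distrib)
  also have "\<dots> \<le> cmod z * (c * L2_set (\<lambda>j. cmod (v j)) {..<n})"
    by (intro mult_left_mono mat_boundD assms) simp
  finally show "L2_set (\<lambda>i. cmod (\<Sum>j<n. (z * a i j) * v j)) {..<n}
      \<le> cmod z * c * L2_set (\<lambda>j. cmod (v j)) {..<n}" by (simp add: mult.assoc)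
qed

lemma mat_bound_0: "mat_bound n (\<lambda>i j. 0) 0"
  by (simp add: mat_bound_def L2_set_def)

lemma mat_bound_sum:
  assumes "\<And>k. k \<in> K \<Longrightarrow> mat_bound n (a k) (c k)"
  shows "mat_bound n (\<lambda>i j. \<Sum>k\<in>K. a k i j) (\<Sum>k\<in>K. c k)"
  using assms
  by (induction K rule: infinite_finite_induct) (auto simp: mat_bound_0 intro: mat_bound_add)

text \<open>
  Cauchy--Schwarz in each row. The factor \<open>n\<close> is the price for knowing only the size of the entries;
  it is why the maps constructed below are allowed errors of order \<open>1 / n\<close> and no more.
\<close>

lemma mat_bound_entries:
  assumes "\<And>i j. i < n \<Longrightarrow> j < n \<Longrightarrow> cmod (a i j) \<le> \<eta>" "0 \<le> \<eta>"
  shows "mat_bound n a (n * \<eta>)"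
  unfolding mat_bound_def
proof
  fix v :: "nat \<Rightarrow> complex"
  let ?v = "L2_set (\<lambda>j. cmod (v j)) {..<n}"
  have row: "cmod (\<Sum>j<n. a i j * v j) \<le> \<eta> * (sqrt n * ?v)" if "i < n" for i
  proof -
    have "cmod (\<Sum>j<n. a i j * v j) \<le> (\<Sum>j<n. \<eta> * cmod (v j))"
      by (rule sum_norm_le) (use that in \<open>auto simp: norm_mult intro!: mult_right_mono assms\<close>)
    also have "\<dots> = \<eta> * (\<Sum>j<n. \<bar>1\<bar> * \<bar>cmod (v j)\<bar>)" by (simp add: sum_distrib_left)
    also have "\<dots> \<le> \<eta> * (L2_set (\<lambda>_. 1) {..<n} * ?v)"
      by (intro mult_left_mono L2_set_mult_ineq assms)
    finally show ?thesis by (simp add: L2_set_def)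
  qed
  have "L2_set (\<lambda>i. cmod (\<Sum>j<n. a i j * v j)) {..<n}
      \<le> L2_set (\<lambda>i. \<eta> * (sqrt n * ?v)) {..<n}"
    by (intro L2_set_mono) (use row in auto)
  also have "\<dots> = sqrt n * (\<eta> * (sqrt n * ?v))"
  proof -
    have "L2_set (\<lambda>_. C) {..<n} = sqrt n * C" if "0 \<le> C" for C
      using that by (simp add: L2_set_def real_sqrt_mult)
    then show ?thesis using assms(2) L2_set_nonneg by simp
  qed
  also have "\<dots> = n * \<eta> * ?v" by simp
  finally show "L2_set (\<lambda>i. cmod (\<Sum>j<n. a i j * v j)) {..<n} \<le> n * \<eta> * ?v" .
qed

lemma mat_bound_entry_le:
  assumes "mat_bound n a c" "i < n" "j < n"
  shows "cmod (a i j) \<le> c"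
proof -
  define v :: "nat \<Rightarrow> complex" where "v = (\<lambda>l. if l = j then 1 else 0)"
  have "(\<Sum>l<n. (cmod (v l))\<^sup>2) = (\<Sum>l<n. if l = j then 1 else 0)"
    by (rule sum.cong) (auto simp: v_def)
  then have v: "L2_set (\<lambda>j. cmod (v j)) {..<n} = 1"
    using assms by (simp add: L2_set_def)
  have "cmod (a i j) = cmod (\<Sum>l<n. a i l * v l)"
    using assms(3) by (simp add: v_def if_distrib[of "(*) _"] cong: if_cong)
  also have "\<dots> \<le> L2_set (\<lambda>i. cmod (\<Sum>l<n. a i l * v l)) {..<n}"
    using assms(2) by (intro member_le_L2_set) auto
  also have "\<dots> \<le> c" using mat_boundD[OF assms(1), of v] by (simp add: v)
  finally show ?thesis .
qed

lemma L2_set_norm_ell2_sq: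
  "(L2_set (\<lambda>j. norm (x j)) {..<n})\<^sup>2 = (\<Sum>t. \<Sum>j<n. (cmod (Rep_ell2 (x j) t))\<^sup>2)"
proof -
  have "(L2_set (\<lambda>j. norm (x j)) {..<n})\<^sup>2 = (\<Sum>j<n. (norm (x j))\<^sup>2)"
    by (simp add: L2_set_def sum_nonneg)
  also have "\<dots> = (\<Sum>j<n. \<Sum>t. (cmod (Rep_ell2 (x j) t))\<^sup>2)" by (simp add: ell2_norm_sq)
  also have "\<dots> = (\<Sum>t. \<Sum>j<n. (cmod (Rep_ell2 (x j) t))\<^sup>2)"
    by (rule suminf_sum[symmetric]) (rule summable_Rep_ell2)
  finally show ?thesis .
qed

text \<open>
  A matrix of diagonal operators is, after regrouping coordinates, a direct sum over \<open>t\<close> of the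
  scalar matrices of its \<open>t\<close>-th diagonal entries, and the norm of a direct sum is the supremum of the
  norms. This says that diagonal operators carry the minimal operator space structure: a matrix norm
  estimate is a scalar estimate that is uniform over the coordinate functionals.
\<close>

lemma matrix_norm_le_iff:
  assumes A: "A \<in> carrier_mat n n"
    and diag: "\<And>i j. i < n \<Longrightarrow> j < n \<Longrightarrow> is_diag (A $$ (i, j))"
    and c: "0 \<le> c"
  shows "matrix_norm A \<le> c \<longleftrightarrow> (\<forall>t. mat_bound n (\<lambda>i j. diag_entry (A $$ (i, j)) t) c)"
proof
  let ?N = "\<lambda>x. L2_set (\<lambda>i. norm (\<Sum>j<n. blinfun_apply (A $$ (i, j)) (x j))) {..<n}"
  have mn: "matrix_norm A = (SUP x \<in> {x. L2_set (\<lambda>j. norm (x j)) {..<n} \<le> 1}. ?N x)"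
    and bdd: "bdd_above (?N ` {x. L2_set (\<lambda>j. norm (x j)) {..<n} \<le> 1})"
    using matrix_norm_bdd_above[of A] A by (auto simp: matrix_norm_def)
  show "\<forall>t. mat_bound n (\<lambda>i j. diag_entry (A $$ (i, j)) t) c" if le: "matrix_norm A \<le> c"
  proof
    fix t
    let ?a = "\<lambda>i j. diag_entry (A $$ (i, j)) t"
    have unit: "L2_set (\<lambda>i. cmod (\<Sum>j<n. ?a i j * v j)) {..<n} \<le> c"
      if v: "L2_set (\<lambda>j. cmod (v j)) {..<n} \<le> 1" for v
    proof -
      define x where "x = (\<lambda>j. v j *\<^sub>C unit_seq t)"
      have "L2_set (\<lambda>j. norm (x j)) {..<n} \<le> 1" using v by (simp add: x_def norm_scaleC)
      then have "?N x \<le> matrix_norm A" unfolding mn by (intro cSUP_upper bdd) simp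
      moreover have "L2_set (\<lambda>i. cmod (\<Sum>j<n. ?a i j * v j)) {..<n} \<le> ?N x"
      proof (rule L2_set_mono)
        fix i assume "i \<in> {..<n}"
        then have "(\<Sum>j<n. ?a i j * v j)
            = Rep_ell2 (\<Sum>j<n. blinfun_apply (A $$ (i, j)) (x j)) t"
          unfolding Rep_ell2_sum using diag
          by (intro sum.cong) (auto simp: is_diag_def x_def scaleC_ell2.rep_eq unit_seq.rep_eq)
        then show "cmod (\<Sum>j<n. ?a i j * v j)
            \<le> norm (\<Sum>j<n. blinfun_apply (A $$ (i, j)) (x j))"
          using ell2_coord_le by metis
      qed simp
      ultimately show ?thesis using le by linarith
    qed
    show "mat_bound n ?a c"
      unfolding mat_bound_def
    proof
      fix v :: "nat \<Rightarrow> complex"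
      let ?v = "L2_set (\<lambda>j. cmod (v j)) {..<n}"
      show "L2_set (\<lambda>i. cmod (\<Sum>j<n. ?a i j * v j)) {..<n} \<le> c * ?v"
      proof (cases "?v = 0")
        case True
        then have "\<forall>j<n. v j = 0" by (simp add: L2_set_eq_0_iff)
        then show ?thesis by (simp add: L2_set_def)
      next
        case False
        then have pos: "?v > 0" using L2_set_nonneg less_eq_real_def by metis
        define w where "w = (\<lambda>j. v j / ?v)"
        have "L2_set (\<lambda>j. cmod (w j)) {..<n} = L2_set (\<lambda>j. (1 / ?v) * cmod (v j)) {..<n}"
          using pos by (simp add: w_def norm_divide)
        also have "\<dots> = (1 / ?v) * ?v" by (rule L2_set_right_distrib[symmetric]) (use pos in simp)
        finally have "L2_set (\<lambda>j. cmod (w j)) {..<n} \<le> 1" using pos by simp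
        from unit[OF this] have le: "L2_set (\<lambda>i. cmod (\<Sum>j<n. ?a i j * w j)) {..<n} \<le> c" .
        have "L2_set (\<lambda>i. cmod (\<Sum>j<n. ?a i j * v j)) {..<n}
            = L2_set (\<lambda>i. ?v * cmod (\<Sum>j<n. ?a i j * w j)) {..<n}"
        proof (rule L2_set_cong[OF refl])
          fix i
          have "(\<Sum>j<n. ?a i j * v j) = of_real ?v * (\<Sum>j<n. ?a i j * w j)"
            using pos by (simp add: sum_distrib_left w_def)
          then show "cmod (\<Sum>j<n. ?a i j * v j) = ?v * cmod (\<Sum>j<n. ?a i j * w j)"
            using pos by (simp add: norm_mult)
        qed
        also have "\<dots> = ?v * L2_set (\<lambda>i. cmod (\<Sum>j<n. ?a i j * w j)) {..<n}"
          by (simp add: L2_set_right_distrib)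
        also have "\<dots> \<le> c * ?v" using le pos by simp
        finally show ?thesis .
      qed
    qed
  qed
  show "matrix_norm A \<le> c" if bound: "\<forall>t. mat_bound n (\<lambda>i j. diag_entry (A $$ (i, j)) t) c"
    unfolding mn
  proof (rule cSUP_least)
    show "{x :: nat \<Rightarrow> ell2. L2_set (\<lambda>j. norm (x j)) {..<n} \<le> 1} \<noteq> {}"
      by (auto intro!: exI[of _ "\<lambda>_. 0"] simp: L2_set_def)
    fix x :: "nat \<Rightarrow> ell2" assume "x \<in> {x. L2_set (\<lambda>j. norm (x j)) {..<n} \<le> 1}"
    then have x: "L2_set (\<lambda>j. norm (x j)) {..<n} \<le> 1" by simp
    define y where "y = (\<lambda>i. \<Sum>j<n. blinfun_apply (A $$ (i, j)) (x j))"
    have y: "Rep_ell2 (y i) t = (\<Sum>j<n. diag_entry (A $$ (i, j)) t * Rep_ell2 (x j) t)"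
      if "i < n" for i t
      unfolding y_def Rep_ell2_sum using diag that by (intro sum.cong) (auto simp: is_diag_def)
    have "(L2_set (\<lambda>i. norm (y i)) {..<n})\<^sup>2 = (\<Sum>t. \<Sum>i<n. (cmod (Rep_ell2 (y i) t))\<^sup>2)"
      by (rule L2_set_norm_ell2_sq)
    also have "\<dots> \<le> (\<Sum>t. c\<^sup>2 * (\<Sum>j<n. (cmod (Rep_ell2 (x j) t))\<^sup>2))"
    proof (rule suminf_le)
      fix t
      have "(\<Sum>i<n. (cmod (Rep_ell2 (y i) t))\<^sup>2)
          = (L2_set (\<lambda>i. cmod (\<Sum>j<n. diag_entry (A $$ (i, j)) t * Rep_ell2 (x j) t)) {..<n})\<^sup>2"
        by (simp add: L2_set_def sum_nonneg y)
      also have "\<dots> \<le> (c * L2_set (\<lambda>j. cmod (Rep_ell2 (x j) t)) {..<n})\<^sup>2"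
        using bound by (intro power_mono mat_boundD) auto
      also have "\<dots> = c\<^sup>2 * (\<Sum>j<n. (cmod (Rep_ell2 (x j) t))\<^sup>2)"
        by (simp add: L2_set_def sum_nonneg power_mult_distrib)
      finally show "(\<Sum>i<n. (cmod (Rep_ell2 (y i) t))\<^sup>2)
          \<le> c\<^sup>2 * (\<Sum>j<n. (cmod (Rep_ell2 (x j) t))\<^sup>2)" .
    qed (intro summable_sum summable_mult summable_Rep_ell2)+
    also have "\<dots> = c\<^sup>2 * (L2_set (\<lambda>j. norm (x j)) {..<n})\<^sup>2"
      by (simp add: L2_set_norm_ell2_sq suminf_mult summable_sum summable_Rep_ell2)
    also have "\<dots> \<le> c\<^sup>2" using x by (intro mult_left_le) (auto simp: power_le_one)
    finally have "L2_set (\<lambda>i. norm (y i)) {..<n} \<le> c" using c power2_le_imp_le by blast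
    then show "?N x \<le> c" by (simp add: y_def)
  qed
qed

lemma matrix_norm_nonneg: "0 \<le> matrix_norm A"
proof -
  have "L2_set (\<lambda>i. norm (\<Sum>j<dim_col A. blinfun_apply (A $$ (i, j)) 0)) {..<dim_row A}
      \<le> matrix_norm A"
    unfolding matrix_norm_def
    by (rule cSUP_upper2[OF matrix_norm_bdd_above, of "\<lambda>_. 0"]) (auto simp: L2_set_def)
  then show ?thesis using L2_set_nonneg order_trans by blast
qed


section \<open>Separable operator spaces given by generators\<close>

lemma scale_op_add_right: "scale_op c (A + B) = scale_op c A + scale_op c B"
  by (rule blinfun_eqI) (simp add: scale_op.rep_eq plus_blinfun.rep_eq scaleC_add_right)

lemma scale_op_add_left: "scale_op (c + d) A = scale_op c A + scale_op d A"
  by (rule blinfun_eqI) (simp add: scale_op.rep_eq plus_blinfun.rep_eq scaleC_add_left)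

lemma scale_op_scale_op: "scale_op c (scale_op d A) = scale_op (c * d) A"
  by (rule blinfun_eqI) (simp add: scale_op.rep_eq scaleC_scaleC)

lemma scaleR_eq_scale_op: "r *\<^sub>R A = scale_op (complex_of_real r) A"
  by (rule blinfun_eqI) (simp add: scale_op.rep_eq scaleR_blinfun.rep_eq scaleR_scaleC)

lemma scale_op_one [simp]: "scale_op 1 A = A"
  using scaleR_eq_scale_op[of 1 A] by simp

lemma scale_op_zero_left [simp]: "scale_op 0 A = 0"
  using scaleR_eq_scale_op[of 0 A] by simp

lemma scale_op_zero_right [simp]: "scale_op c 0 = 0"
  using scale_op_add_right[of c 0 0] by simp

lemma norm_scale_op_le: "norm (scale_op c A) \<le> norm A * cmod c"
proof (rule norm_blinfun_bound)
  fix x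
  show "norm (blinfun_apply (scale_op c A) x) \<le> norm A * cmod c * norm x"
    using mult_left_mono[OF norm_blinfun[of A x], of "cmod c"]
    by (simp add: scale_op.rep_eq norm_scaleC mult.assoc mult.left_commute)
qed simp

lemma bounded_linear_scale_op_right: "bounded_linear (scale_op c)"
  by (rule bounded_linear_intro[where K = "cmod c"])
    (simp_all add: scale_op_add_right scaleR_eq_scale_op scale_op_scale_op norm_scale_op_le
      mult.commute[of c])

lemma bounded_linear_scale_op_left: "bounded_linear (\<lambda>c. scale_op c A)"
proof (rule bounded_linear_intro[where K = "norm A"])
  show "norm (scale_op c A) \<le> norm c * norm A" for c
    using norm_scale_op_le[of c A] by (simp add: mult.commute)
qed (simp_all add: scale_op_add_left scaleR_eq_scale_op scale_op_scale_op scaleR_conv_of_real)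

lemma complex_operators_add:
  "A \<in> complex_operators \<Longrightarrow> B \<in> complex_operators \<Longrightarrow> A + B \<in> complex_operators"
  by (simp add: complex_operators_def plus_blinfun.rep_eq scaleC_add_right)

lemma complex_operators_scale: "A \<in> complex_operators \<Longrightarrow> scale_op c A \<in> complex_operators"
  by (simp add: complex_operators_def scale_op.rep_eq scaleC_scaleC mult.commute)

lemma closed_complex_operators: "closed complex_operators"
proof -
  have "(complex_operators :: ('a \<Rightarrow>\<^sub>L 'a) set)
      = (\<Inter>c. \<Inter>x. {A. blinfun_apply A (c *\<^sub>C x) = c *\<^sub>C blinfun_apply A x})"
    by (auto simp: complex_operators_def)
  also have "closed \<dots>"
    by (intro closed_INT ballI closed_Collect_eq linear_continuous_on
        bounded_linear_compose[OF bounded_linear_scaleC] bounded_linear_intros)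
  finally show ?thesis .
qed

definition cx_rat :: "rat \<Rightarrow> rat \<Rightarrow> complex" where
  "cx_rat p q = Complex (of_rat p) (of_rat q)"

lemma closed_containing_cx_rat_UNIV:
  assumes "closed S" "\<And>p q. cx_rat p q \<in> S"
  shows "z \<in> S"
proof -
  have "\<exists>w\<in>S. dist w z < e" if e: "e > 0" for e
  proof -
    obtain p where p: "Re z < of_rat p" "of_rat p < Re z + e / 2"
      using of_rat_dense[of "Re z" "Re z + e / 2"] e by auto
    obtain q where q: "Im z < of_rat q" "of_rat q < Im z + e / 2"
      using of_rat_dense[of "Im z" "Im z + e / 2"] e by auto
    have "dist (cx_rat p q) z \<le> \<bar>Re (cx_rat p q - z)\<bar> + \<bar>Im (cx_rat p q - z)\<bar>"
      unfolding dist_norm by (rule cmod_le)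
    also have "\<dots> < e" using p q by (simp add: cx_rat_def)
    finally show ?thesis using assms(2) by blast
  qed
  then have "z \<in> closure S" by (simp add: closure_approachable)
  then show ?thesis using assms(1) by simp
qed

text \<open>
  Finite combinations with Gaussian rational coefficients, recorded as lists: concatenation is
  addition, and there are only countably many of them. Their closure is therefore visibly separable,
  and it is a complex subspace because the Gaussian rationals are dense.
\<close>

definition rat_comb ::
  "('g \<Rightarrow> 'h::complex_hilbert_space \<Rightarrow>\<^sub>L 'h) \<Rightarrow> ('g \<times> rat \<times> rat) list \<Rightarrow> 'h \<Rightarrow>\<^sub>L 'h" where
  "rat_comb b l = (\<Sum>(g, p, q)\<leftarrow>l. scale_op (cx_rat p q) (b g))"

definition gen_space :: "('g::countable \<Rightarrow> 'h::complex_hilbert_space \<Rightarrow>\<^sub>L 'h) \<Rightarrow> ('h \<Rightarrow>\<^sub>L 'h) set"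
  where "gen_space b = closure (range (rat_comb b))"

lemma rat_comb_append: "rat_comb b (l @ m) = rat_comb b l + rat_comb b m"
  by (simp add: rat_comb_def)

lemma rat_comb_scale:
  "scale_op (cx_rat r s) (rat_comb b l)
    = rat_comb b (map (\<lambda>(g, p, q). (g, r * p - s * q, r * q + s * p)) l)"
proof (induction l)
  case (Cons a l)
  have "cx_rat r s * cx_rat p q = cx_rat (r * p - s * q) (r * q + s * p)" for p q
    by (simp add: cx_rat_def complex_eq_iff of_rat_mult of_rat_diff of_rat_add)
  with Cons show ?case
    by (cases a) (simp add: rat_comb_def scale_op_add_right scale_op_scale_op)
qed (simp add: rat_comb_def)

lemma gen_space_rat_comb: "rat_comb b l \<in> gen_space b"
  unfolding gen_space_def by (rule subsetD[OF closure_subset rangeI])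

text \<open>
  A closed property of operators holds on the generated space once it survives adding a multiple of
  a generator. Identities between continuous linear functionals are checked on generators this way.
\<close>

lemma gen_space_induct [consumes 1, case_names closed zero add]:
  assumes "A \<in> gen_space b"
    and closed: "closed {A. P A}"
    and zero: "P 0"
    and add: "\<And>A c g. P A \<Longrightarrow> P (scale_op c (b g) + A)"
  shows "P A"
proof -
  have "P (rat_comb b l)" for l
    by (induction l) (auto simp: rat_comb_def zero add)
  then have "range (rat_comb b) \<subseteq> {A. P A}" by auto
  then show ?thesis
    using closure_minimal[OF _ closed] assms(1) unfolding gen_space_def by blast
qed

lemma gen_space_0: "0 \<in> gen_space b"
  using gen_space_rat_comb[of b "[]"] by (simp add: rat_comb_def)

lemma gen_space_add:
  assumes "A \<in> gen_space b" "B \<in> gen_space b"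
  shows "A + B \<in> gen_space b"
proof -
  let ?R = "range (rat_comb b)"
  have "(\<lambda>z. fst z + snd z) ` closure (?R \<times> ?R) \<subseteq> gen_space b"
  proof (rule image_closure_subset)
    show "continuous_on (closure (?R \<times> ?R)) (\<lambda>z. fst z + snd z)" by (intro continuous_intros)
    show "(\<lambda>z. fst z + snd z) ` (?R \<times> ?R) \<subseteq> gen_space b"
    proof (rule image_subsetI)
      fix z assume "z \<in> ?R \<times> ?R"
      then obtain l m where "fst z + snd z = rat_comb b l + rat_comb b m" by auto
      then show "fst z + snd z \<in> gen_space b" by (metis rat_comb_append gen_space_rat_comb)
    qed
  qed (simp add: gen_space_def)
  moreover have "(A, B) \<in> closure (?R \<times> ?R)"
    using assms by (simp add: gen_space_def closure_Times)
  ultimately have "(\<lambda>z. fst z + snd z) (A, B) \<in> gen_space b" by (rule subsetD[OF _ imageI])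
  then show ?thesis by simp
qed

lemma gen_space_scale:
  assumes "A \<in> gen_space b"
  shows "scale_op c A \<in> gen_space b"
proof -
  have rat: "scale_op (cx_rat p q) A \<in> gen_space b" for p q
  proof -
    have "scale_op (cx_rat p q) ` closure (range (rat_comb b)) \<subseteq> gen_space b"
    proof (rule image_closure_subset)
      show "continuous_on (closure (range (rat_comb b))) (scale_op (cx_rat p q))"
        by (intro linear_continuous_on bounded_linear_scale_op_right)
      show "scale_op (cx_rat p q) ` range (rat_comb b) \<subseteq> gen_space b"
      proof (intro image_subsetI)
        fix C assume "C \<in> range (rat_comb b)"
        then obtain l where "C = rat_comb b l" by blast
        then show "scale_op (cx_rat p q) C \<in> gen_space b"
          by (simp only: rat_comb_scale gen_space_rat_comb)
      qed
    qed (simp add: gen_space_def)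
    then show ?thesis using assms by (auto simp: gen_space_def)
  qed
  have "closed ((\<lambda>c. scale_op c A) -` gen_space b)"
    unfolding gen_space_def
    by (intro closed_vimage linear_continuous_on bounded_linear_scale_op_left closed_closure)
  then have "c \<in> (\<lambda>c. scale_op c A) -` gen_space b"
    by (rule closed_containing_cx_rat_UNIV) (use rat in \<open>simp only: vimage_eq\<close>)
  then show ?thesis by (rule vimageD)
qed

lemma gen_space_generator: "b g \<in> gen_space b"
  using gen_space_rat_comb[of b "[(g, 1, 0)]"]
  by (simp add: rat_comb_def cx_rat_def one_complex.code[symmetric])

lemma gen_space_sum: "(\<And>i. i \<in> I \<Longrightarrow> A i \<in> gen_space b) \<Longrightarrow> (\<Sum>i\<in>I. A i) \<in> gen_space b"
  by (induction I rule: infinite_finite_induct) (auto simp: gen_space_0 gen_space_add)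

lemma separable_operator_space_gen_space:
  assumes "\<And>g. b g \<in> complex_operators"
  shows "separable_operator_space (gen_space b)"
  unfolding separable_operator_space_def operator_space_def
proof (intro conjI ballI allI subsetI)
  show "A \<in> complex_operators" if "A \<in> gen_space b" for A
    using that
  proof (induction rule: gen_space_induct)
    case closed
    show ?case using closed_complex_operators by simp
  next
    case zero
    have "c *\<^sub>C (0 :: 'b) = 0" for c by (metis norm_eq_zero norm_scaleC mult_zero_right)
    then show ?case by (simp add: complex_operators_def)
  qed (intro complex_operators_add complex_operators_scale assms)
  have "countable (range (rat_comb b))" by (rule countable_image) simp
  moreover have "range (rat_comb b) \<subseteq> gen_space b" by (intro image_subsetI gen_space_rat_comb)
  moreover have "top_of_set (gen_space b) closure_of range (rat_comb b) = gen_space b"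
    by (auto simp: closure_of_subtopology gen_space_def Int_absorb1 closure_subset)
  ultimately show "separable_space (top_of_set (gen_space b))"
    unfolding separable_space_def by (intro exI[of _ "range (rat_comb b)"]) simp
qed (auto simp: gen_space_0 gen_space_add gen_space_scale, simp add: gen_space_def)

lemma is_diag_gen_space:
  assumes "\<And>g. is_diag (b g)" "A \<in> gen_space b"
  shows "is_diag A"
  using assms(2)
proof (induction rule: gen_space_induct)
  case closed
  show ?case by (rule closed_is_diag)
next
  case zero
  show ?case by (rule is_diag_0)
next
  case (add A c g)
  show ?case by (intro is_diag_add is_diag_scale assms(1) add)
qed


section \<open>The gliding hump\<close>

text \<open>
  The mechanism that makes unconditionally bounded sums small in an \<open>\<ell>\<^sub>1\<close>-type space. Think of
  \<open>P k F\<close> as the \<open>k\<close>-th block norm of \<open>\<Sum>i\<in>F. u i\<close> and of \<open>\<Sum>k. P k F\<close> as the norm of that sum. If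
  each block norm of \<open>u i\<close> tends to \<open>0\<close> but the norms do not, one can keep adding vectors \<open>u i\<close> that
  live essentially beyond the blocks already occupied; each addition then raises the norm by a fixed
  amount, contradicting the bound \<open>C\<close>. The lemma is formulated for the numbers \<open>P k F\<close> alone because
  it is applied at two different scales.
\<close>

lemma gliding_hump:
  fixes P :: "nat \<Rightarrow> nat set \<Rightarrow> real"
  assumes nonneg: "\<And>k F. 0 \<le> P k F"
    and subadd: "\<And>k F i. finite F \<Longrightarrow> i \<notin> F \<Longrightarrow> \<bar>P k F - P k {i}\<bar> \<le> P k (insert i F)"
    and bounded: "\<And>F K. finite F \<Longrightarrow> (\<Sum>k<K. P k F) \<le> C"
    and null: "\<And>k. (\<lambda>i. P k {i}) \<longlonglongrightarrow> 0"
    and "\<eta> > 0"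
  shows "\<forall>\<^sub>F i in sequentially. \<forall>K. (\<Sum>k<K. P k {i}) \<le> \<eta>"
proof (rule ccontr)
  assume "\<not> ?thesis"
  then have freq: "\<exists>\<^sub>F i in sequentially. \<exists>K. \<eta> < (\<Sum>k<K. P k {i})"
    by (simp add: frequently_def not_less)
  have "\<exists>F K. finite F \<and> real m * (\<eta> / 2) \<le> (\<Sum>k<K. P k F)" for m
  proof (induction m)
    case 0
    have "0 \<le> (\<Sum>k<0. P k {})" by simp
    then show ?case by (metis finite.emptyI mult_zero_left of_nat_0)
  next
    case (Suc m)
    then obtain F K where F: "finite F" and K: "real m * (\<eta> / 2) \<le> (\<Sum>k<K. P k F)" by blast
    have "summable (\<lambda>k. P k F)"
      by (rule summableI_nonneg_bounded[OF nonneg bounded[OF F]])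
    then obtain M0 where M0: "\<And>m n. M0 \<le> m \<Longrightarrow> norm (\<Sum>k\<in>{m..<n}. P k F) < \<eta> / 8"
      using \<open>\<eta> > 0\<close> unfolding summable_Cauchy by (metis zero_less_divide_iff zero_less_numeral)
    \<comment> \<open>The blocks below M carry the sum over F up to a small tail; the next vector is chosen
        so that it is small on them.\<close>
    define M where "M = max K M0"
    have tail: "(\<Sum>k\<in>{M..<n}. P k F) \<le> \<eta> / 8" for n
      using M0[of M n] by (simp add: M_def)
    have "(\<lambda>i. \<Sum>k<M. P k {i}) \<longlonglongrightarrow> (\<Sum>k<M. 0)" by (intro tendsto_sum null)
    then have "\<forall>\<^sub>F i in sequentially. (\<Sum>k<M. P k {i}) < \<eta> / 8"
      using \<open>\<eta> > 0\<close> order_tendstoD(2)[of _ 0 sequentially "\<eta> / 8"] by simp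
    moreover have "\<forall>\<^sub>F i in sequentially. i \<notin> F"
    proof -
      obtain m where "\<forall>i\<in>F. i < m" using F by (auto simp: finite_nat_set_iff_bounded)
      then have "i \<notin> F" if "m \<le> i" for i using that by auto
      then show ?thesis using eventually_sequentially by blast
    qed
    ultimately have "\<forall>\<^sub>F i in sequentially. (\<Sum>k<M. P k {i}) < \<eta> / 8 \<and> i \<notin> F"
      by (rule eventually_conj)
    with freq have "\<exists>\<^sub>F i in sequentially. ((\<Sum>k<M. P k {i}) < \<eta> / 8 \<and> i \<notin> F)
        \<and> (\<exists>K. \<eta> < (\<Sum>k<K. P k {i}))"
      by (rule frequently_eventually_conj)
    then obtain i L where L: "\<eta> < (\<Sum>k<L. P k {i})" and head: "(\<Sum>k<M. P k {i}) < \<eta> / 8"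
      and i: "i \<notin> F" using frequently_ex by blast
    have split: "(\<Sum>k<max L M. g k) = (\<Sum>k<M. g k) + (\<Sum>k\<in>{M..<max L M}. g k)"
      for g :: "nat \<Rightarrow> real"
      by (subst sum.union_disjoint[symmetric]) (auto intro!: sum.cong)
    have "(\<Sum>k<K. P k F) \<le> (\<Sum>k<M. P k F)"
      by (rule sum_mono2) (auto simp: M_def nonneg)
    moreover have "(\<Sum>k<L. P k {i}) \<le> (\<Sum>k<max L M. P k {i})"
      by (rule sum_mono2) (auto simp: nonneg)
    ultimately have "real m * (\<eta> / 2) - \<eta> / 8 + ((\<eta> - \<eta> / 8) - \<eta> / 8)
        \<le> ((\<Sum>k<M. P k F) - (\<Sum>k<M. P k {i}))
          + ((\<Sum>k\<in>{M..<max L M}. P k {i}) - (\<Sum>k\<in>{M..<max L M}. P k F))"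
      using K L head tail[of "max L M"] split[of "\<lambda>k. P k {i}"] by linarith
    also have "\<dots> = (\<Sum>k<M. P k F - P k {i}) + (\<Sum>k\<in>{M..<max L M}. P k {i} - P k F)"
      by (simp add: sum_subtractf)
    also have "\<dots> \<le> (\<Sum>k<M. P k (insert i F)) + (\<Sum>k\<in>{M..<max L M}. P k (insert i F))"
    proof (intro add_mono sum_mono)
      show "P k F - P k {i} \<le> P k (insert i F)" "P k {i} - P k F \<le> P k (insert i F)" for k
        using subadd[OF F i, of k] by linarith+
    qed
    also have "\<dots> = (\<Sum>k<max L M. P k (insert i F))" by (simp add: split)
    finally have "real (Suc m) * (\<eta> / 2) \<le> (\<Sum>k<max L M. P k (insert i F))"
      using \<open>\<eta> > 0\<close> by (simp add: algebra_simps)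
    then show ?case using F by (meson finite_insert)
  qed
  then have "real m * (\<eta> / 2) \<le> C" for m
    using bounded order_trans by meson
  moreover obtain m where "C / (\<eta> / 2) < real m" using reals_Archimedean2 by blast
  ultimately show False using \<open>\<eta> > 0\<close> by (metis half_gt_zero not_less pos_divide_less_eq)
qed


section \<open>The two spaces\<close>

definition c0_gen :: "nat \<Rightarrow> ell2 \<Rightarrow>\<^sub>L ell2" where
  "c0_gen j = diag_op (\<lambda>t. if t = j then 1 else 0)"

definition c0_space :: "(ell2 \<Rightarrow>\<^sub>L ell2) set" where
  "c0_space = gen_space c0_gen"

lemma is_diag_c0_gen: "is_diag (c0_gen j)"
  unfolding c0_gen_def by (rule is_diag_diag_op[where c = 1]) simp

lemma diag_entry_c0_gen: "diag_entry (c0_gen j) t = (if t = j then 1 else 0)"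
  unfolding c0_gen_def by (rule diag_entry_diag_op[where c = 1]) simp

lemma is_diag_c0_space: "A \<in> c0_space \<Longrightarrow> is_diag A"
  unfolding c0_space_def using is_diag_gen_space is_diag_c0_gen by blast

lemma c0_space_entries_finite:
  assumes "A \<in> c0_space" "\<delta> > 0"
  shows "finite {i. \<delta> \<le> cmod (diag_entry A i)}"
proof -
  have fin: "finite {i. diag_entry (rat_comb c0_gen l) i \<noteq> 0}" for l
  proof (induction l)
    case (Cons a l)
    obtain g p q where a: "a = (g, p, q)" by (cases a)
    have "{i. diag_entry (rat_comb c0_gen (a # l)) i \<noteq> 0}
        \<subseteq> insert g {i. diag_entry (rat_comb c0_gen l) i \<noteq> 0}"
      by (auto simp: a rat_comb_def diag_entry_add diag_entry_scale diag_entry_c0_gen)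
    then show ?case using Cons finite_subset by blast
  qed (simp add: rat_comb_def)
  \<comment> \<open>Finite combinations have finitely many non-zero entries and approximate A.\<close>
  obtain l where l: "dist (rat_comb c0_gen l) A < \<delta>"
    using assms by (auto simp: c0_space_def gen_space_def closure_approachable)
  have "diag_entry (rat_comb c0_gen l) i \<noteq> 0" if "\<delta> \<le> cmod (diag_entry A i)" for i
  proof
    assume "diag_entry (rat_comb c0_gen l) i = 0"
    then have "cmod (diag_entry A i) = cmod (diag_entry (rat_comb c0_gen l - A) i)"
      by (simp add: diag_entry_diff)
    also have "\<dots> < \<delta>" using cmod_diag_entry_le l by (metis dist_norm le_less_trans)
    finally show False using that by simp
  qed
  then show ?thesis by (intro finite_subset[OF _ fin[of l]]) auto
qed

text \<open>
  The value \<open>0\<close> at \<open>0\<close> allows a test functional to ignore a level or a coordinate. The four powers of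
  \<open>\<i>\<close> suffice to recover moduli up to the factor \<open>2\<close>, and keep the set of functionals countable.
\<close>

definition phase :: "nat \<Rightarrow> complex" where
  "phase m = (case m of 0 \<Rightarrow> 0 | Suc k \<Rightarrow> \<i> ^ k)"

lemma phase_0 [simp]: "phase 0 = 0" and phase_1 [simp]: "phase 1 = 1" "phase (Suc 0) = 1"
  by (simp_all add: phase_def)

lemma norm_phase_le: "cmod (phase m) \<le> 1"
  by (simp add: phase_def norm_power split: nat.split)

lemma ex_phase: "\<exists>m. cmod z / 2 \<le> Re (phase m * z)"
proof -
  have "cmod z \<le> \<bar>Re z\<bar> + \<bar>Im z\<bar>" by (rule cmod_le)
  then consider "cmod z / 2 \<le> Re z" | "cmod z / 2 \<le> - Im z" | "cmod z / 2 \<le> - Re z"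
    | "cmod z / 2 \<le> Im z" by argo
  then show ?thesis
  proof cases
    case 1
    then show ?thesis by (intro exI[of _ 1]) simp
  next
    case 2
    then show ?thesis by (intro exI[of _ 2]) (simp add: phase_def numeral_2_eq_2)
  next
    case 3
    then show ?thesis by (intro exI[of _ 3]) (simp add: phase_def numeral_3_eq_3)
  next
    case 4
    then show ?thesis by (intro exI[of _ "Suc (Suc (Suc (Suc 0)))"]) (simp add: phase_def)
  qed
qed

text \<open>
  A generator of the second space has a level \<open>k\<close> and a code \<open>s\<close>, read as the finite set
  \<open>set_decode s\<close>. On level \<open>k\<close> sits \<open>\<ell>\<^sub>1\<close> of the finite subsets of \<open>\<nat>\<close>, with the norm
  \<open>max \<parallel>Q y\<parallel>\<^sub>\<infinity> (2 powr (- k) * \<parallel>y\<parallel>\<^sub>1)\<close>, where \<open>Q\<close> maps the basis vector of a set to its indicator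
  function and is a quotient map onto \<open>c\<^sub>0\<close>. The functionals \<open>Inl i\<close> evaluate \<open>Q y\<close> at \<open>i\<close>, and the
  functionals \<open>Inr \<sigma>\<close> recover the weighted \<open>\<ell>\<^sub>1\<close>-norm, up to a constant, from patterns of phases.
\<close>

fun level_weight :: "nat \<Rightarrow> nat + nat list \<Rightarrow> nat \<Rightarrow> complex" where
  "level_weight k (Inl i) s = of_bool (i \<in> set_decode s)"
| "level_weight k (Inr \<sigma>) s = (if s < length \<sigma> then (1 / 2) ^ k * phase (\<sigma> ! s) else 0)"

lemma norm_level_weight_le: "cmod (level_weight k d s) \<le> 1"
  using mult_mono[OF power_le_one[of "1 / 2 :: real" k] norm_phase_le]
  by (cases d) (auto simp: norm_mult norm_power norm_divide)

text \<open>
  A test functional chooses on each of finitely many levels a phase and a level functional, and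
  adds the results. Taking the supremum over all tests gives, up to a constant, the \<open>\<ell>\<^sub>1\<close>-sum of the
  level norms. The tests form a countable set, hence can serve as the coordinates of \<open>ell2\<close>.
\<close>

definition test_weight :: "(nat \<times> (nat + nat list)) list \<Rightarrow> nat \<Rightarrow> nat \<Rightarrow> complex" where
  "test_weight \<tau> k s =
     (if k < length \<tau> then phase (fst (\<tau> ! k)) * level_weight k (snd (\<tau> ! k)) s else 0)"

lemma norm_test_weight_le: "cmod (test_weight \<tau> k s) \<le> 1"
  using mult_mono[OF norm_phase_le norm_level_weight_le]
  by (auto simp: test_weight_def norm_mult)

definition l1_gen :: "nat \<times> nat \<Rightarrow> ell2 \<Rightarrow>\<^sub>L ell2" where
  "l1_gen = (\<lambda>(k, s). diag_op (\<lambda>t. test_weight (from_nat t) k s))"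

definition l1_sum_space :: "(ell2 \<Rightarrow>\<^sub>L ell2) set" where
  "l1_sum_space = gen_space l1_gen"

lemma is_diag_l1_gen: "is_diag (l1_gen g)"
  unfolding l1_gen_def case_prod_unfold
  by (rule is_diag_diag_op[where c = 1]) (rule norm_test_weight_le)

lemma diag_entry_l1_gen: "diag_entry (l1_gen (k, s)) t = test_weight (from_nat t) k s"
  unfolding l1_gen_def prod.case
  by (rule diag_entry_diag_op[where c = 1]) (rule norm_test_weight_le)

lemma is_diag_l1_sum_space: "A \<in> l1_sum_space \<Longrightarrow> is_diag A"
  unfolding l1_sum_space_def using is_diag_gen_space is_diag_l1_gen by blast

text \<open>
  The functional \<open>d\<close> on level \<open>k\<close> is itself a test: all other levels get phase \<open>0\<close>. Reading level
  functionals and coefficients off the diagonal defines them on all operators at once, so that no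
  coefficient expansion of a general element of the space is needed.
\<close>

definition level_functional :: "nat \<Rightarrow> nat + nat list \<Rightarrow> (ell2 \<Rightarrow>\<^sub>L ell2) \<Rightarrow> complex" where
  "level_functional k d A = diag_entry A (to_nat (replicate k (0 :: nat, d) @ [(1, d)]))"

definition coord :: "nat \<Rightarrow> nat \<Rightarrow> (ell2 \<Rightarrow>\<^sub>L ell2) \<Rightarrow> complex" where
  "coord k s = level_functional k (Inr (replicate s 0 @ [1]))"

lemma level_functional_0 [simp]: "level_functional k d 0 = 0"
  and level_functional_add:
    "level_functional k d (A + B) = level_functional k d A + level_functional k d B"
  and level_functional_diff:
    "level_functional k d (A - B) = level_functional k d A - level_functional k d B"
  and level_functional_scale: "level_functional k d (scale_op c A) = c * level_functional k d A"
  and level_functional_sum: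
    "level_functional k d (\<Sum>i\<in>I. A' i) = (\<Sum>i\<in>I. level_functional k d (A' i))"
  and norm_level_functional_le: "cmod (level_functional k d A) \<le> norm A"
  and continuous_on_level_functional: "continuous_on S (level_functional k d)"
  by (simp_all add: level_functional_def diag_entry_add diag_entry_diff diag_entry_scale
      diag_entry_sum cmod_diag_entry_le continuous_on_diag_entry cong: continuous_on_cong)

lemma coord_add: "coord k s (A + B) = coord k s A + coord k s B"
  and coord_scale: "coord k s (scale_op c A) = c * coord k s A"
  by (simp_all add: coord_def level_functional_add level_functional_scale)

lemma level_functional_l1_gen:
  "level_functional k d (l1_gen (l, s)) = (if l = k then level_weight k d s else 0)"
  by (auto simp: level_functional_def diag_entry_l1_gen test_weight_def nth_append)

lemma coord_l1_gen: "coord k s (l1_gen (l, r)) = (if l = k \<and> r = s then (1 / 2) ^ k else 0)"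
  by (auto simp: coord_def level_functional_l1_gen nth_append)

lemma diag_entry_l1_sum_space:
  assumes "A \<in> l1_sum_space" and \<tau>: "from_nat t = \<tau>"
  shows "diag_entry A t
    = (\<Sum>k<length \<tau>. phase (fst (\<tau> ! k)) * level_functional k (snd (\<tau> ! k)) A)"
  using assms(1) unfolding l1_sum_space_def
proof (induction rule: gen_space_induct)
  case closed
  show ?case
    by (intro closed_Collect_eq continuous_on_diag_entry continuous_on_sum continuous_on_mult
        continuous_on_const continuous_on_level_functional)
next
  case (add A c g)
  obtain l s where g: "g = (l, s)" by fastforce
  have "test_weight \<tau> l s
      = (\<Sum>k<length \<tau>. phase (fst (\<tau> ! k)) * level_functional k (snd (\<tau> ! k)) (l1_gen (l, s)))"
    by (simp add: level_functional_l1_gen test_weight_def if_distrib[of "(*) _"] sum.delta'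
        cong: if_cong)
  then show ?case
    using add by (simp add: g diag_entry_add diag_entry_scale diag_entry_l1_gen \<tau>
        level_functional_add level_functional_scale sum.distrib algebra_simps sum_distrib_left)
qed simp

lemma level_functional_Inr:
  assumes "A \<in> l1_sum_space"
  shows "level_functional k (Inr \<sigma>) A = (\<Sum>s<length \<sigma>. phase (\<sigma> ! s) * coord k s A)"
  using assms unfolding l1_sum_space_def
proof (induction rule: gen_space_induct)
  case closed
  show ?case unfolding coord_def
    by (intro closed_Collect_eq continuous_on_sum continuous_on_mult
        continuous_on_const continuous_on_level_functional)
next
  case (add A c g)
  obtain l r where g: "g = (l, r)" by fastforce
  have "level_functional k (Inr \<sigma>) (l1_gen (l, r))
      = (\<Sum>s<length \<sigma>. phase (\<sigma> ! s) * coord k s (l1_gen (l, r)))"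
    by (simp add: level_functional_l1_gen coord_l1_gen if_distrib[of "(*) _"] sum.delta'
        cong: if_cong)
  then show ?case
    using add by (simp add: g coord_def level_functional_add level_functional_scale sum.distrib
        algebra_simps sum_distrib_left)
qed (simp add: coord_def)

lemma sum_coord_le:
  assumes "A \<in> l1_sum_space"
  shows "(\<Sum>s<S. cmod (coord k s A)) \<le> 2 * norm A"
proof -
  have "\<forall>s. \<exists>m. cmod (coord k s A) / 2 \<le> Re (phase m * coord k s A)"
    using ex_phase by blast
  from choice[OF this] obtain m
    where m: "\<And>s. cmod (coord k s A) / 2 \<le> Re (phase (m s) * coord k s A)" by blast
  define \<sigma> where "\<sigma> = map m [0..<S]"
  have "(\<Sum>s<S. cmod (coord k s A)) / 2 \<le> (\<Sum>s<S. Re (phase (m s) * coord k s A))"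
    unfolding sum_divide_distrib by (intro sum_mono m)
  also have "\<dots> = Re (level_functional k (Inr \<sigma>) A)"
    using assms by (simp add: level_functional_Inr \<sigma>_def)
  also have "\<dots> \<le> norm A" using complex_Re_le_cmod norm_level_functional_le order_trans by blast
  finally show ?thesis by simp
qed

lemma rat_comb_l1_gen_Inl:
  "\<exists>M. (\<forall>s\<ge>M. coord k s (rat_comb l1_gen l) = 0) \<and> level_functional k (Inl i) (rat_comb l1_gen l)
     = (\<Sum>s<M. of_bool (i \<in> set_decode s) * 2 ^ k * coord k s (rat_comb l1_gen l))"
proof (induction l)
  case (Cons a l)
  let ?B = "rat_comb l1_gen l"
  let ?f = "\<lambda>A s. of_bool (i \<in> set_decode s) * 2 ^ k * coord k s A"
  obtain M where M: "\<forall>s\<ge>M. coord k s ?B = 0" "level_functional k (Inl i) ?B = (\<Sum>s<M. ?f ?B s)"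
    using Cons by blast
  obtain n r p q where a: "a = ((n, r), p, q)" by (metis prod.exhaust)
  let ?N = "max M (Suc r)" and ?G = "l1_gen (n, r)" and ?c = "cx_rat p q"
  have A: "rat_comb l1_gen (a # l) = scale_op ?c ?G + ?B" by (simp add: a rat_comb_def)
  have "(\<Sum>s<M. ?f ?B s) = (\<Sum>s<?N. ?f ?B s)"
    by (rule sum.mono_neutral_left) (auto simp: M)
  moreover have "level_functional k (Inl i) ?G = (\<Sum>s<?N. ?f ?G s)"
  proof -
    have "(\<Sum>s<?N. ?f ?G s) = (\<Sum>s\<in>{r}. ?f ?G s)"
      by (rule sum.mono_neutral_right) (auto simp: coord_l1_gen)
    then show ?thesis by (simp add: level_functional_l1_gen coord_l1_gen power_one_over)
  qed
  ultimately have "level_functional k (Inl i) (rat_comb l1_gen (a # l))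
      = (\<Sum>s<?N. ?f (rat_comb l1_gen (a # l)) s)"
    by (simp add: A level_functional_add level_functional_scale coord_def M sum.distrib
        sum_distrib_left algebra_simps)
  moreover have "\<forall>s\<ge>?N. coord k s (rat_comb l1_gen (a # l)) = 0"
    using M(1) by (simp add: A coord_add coord_scale coord_l1_gen)
  ultimately show ?case by blast
qed (simp add: rat_comb_def coord_def)

text \<open>
  The quotient map is bounded by the \<open>\<ell>\<^sub>1\<close>-norm, with the constant \<open>2 ^ k\<close> because \<open>coord\<close> carries the
  weight of its level. For finite combinations this is the triangle inequality; the general case
  follows by approximation, using that the \<open>\<ell>\<^sub>1\<close>-norm is controlled by the operator norm.
\<close>

lemma norm_level_functional_Inl_le:
  assumes A: "A \<in> l1_sum_space" and c: "\<And>S. (\<Sum>s<S. cmod (coord k s A)) \<le> c"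
  shows "cmod (level_functional k (Inl i) A) \<le> 2 ^ k * c"
proof (rule field_le_epsilon)
  fix e :: real assume "e > 0"
  define \<delta> where "\<delta> = e / (1 + 2 ^ k * 2)"
  have "\<delta> > 0" using \<open>e > 0\<close> by (simp add: \<delta>_def add_pos_pos)
  then obtain l where l: "dist (rat_comb l1_gen l) A < \<delta>"
    using A by (auto simp: l1_sum_space_def gen_space_def closure_approachable)
  let ?B = "rat_comb l1_gen l"
  have B: "?B \<in> l1_sum_space" by (simp add: l1_sum_space_def gen_space_rat_comb)
  have diff: "?B - A \<in> l1_sum_space"
    using gen_space_add[OF B[unfolded l1_sum_space_def] gen_space_scale[OF A[unfolded l1_sum_space_def], of "-1"]]
    by (metis l1_sum_space_def scaleR_eq_scale_op of_real_1 of_real_minus scaleR_minus1_left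
        diff_conv_add_uminus)
  obtain M where M: "level_functional k (Inl i) ?B
      = (\<Sum>s<M. of_bool (i \<in> set_decode s) * 2 ^ k * coord k s ?B)"
    using rat_comb_l1_gen_Inl by blast
  have "cmod (level_functional k (Inl i) ?B) \<le> (\<Sum>s<M. 2 ^ k * cmod (coord k s ?B))"
    unfolding M by (rule sum_norm_le) (simp add: norm_mult norm_power)
  also have "\<dots> \<le> (\<Sum>s<M. 2 ^ k * (cmod (coord k s A) + cmod (coord k s (?B - A))))"
  proof (intro sum_mono mult_left_mono)
    fix s
    have "coord k s ?B = coord k s A + coord k s (?B - A)"
      by (simp add: coord_def level_functional_diff)
    then show "cmod (coord k s ?B) \<le> cmod (coord k s A) + cmod (coord k s (?B - A))"
      by (metis norm_triangle_ineq)
  qed simp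
  also have "\<dots> = 2 ^ k * ((\<Sum>s<M. cmod (coord k s A)) + (\<Sum>s<M. cmod (coord k s (?B - A))))"
    by (simp add: sum_distrib_left sum.distrib distrib_left)
  also have "\<dots> \<le> 2 ^ k * (c + 2 * norm (?B - A))"
    by (intro mult_left_mono add_mono c sum_coord_le diff) simp
  finally have "cmod (level_functional k (Inl i) ?B) \<le> 2 ^ k * (c + 2 * norm (?B - A))" .
  moreover have "cmod (level_functional k (Inl i) A)
      \<le> cmod (level_functional k (Inl i) ?B) + norm (?B - A)"
    using norm_level_functional_le[of k "Inl i" "?B - A"]
      norm_triangle_ineq3[of "level_functional k (Inl i) ?B" "level_functional k (Inl i) A"]
    by (simp add: level_functional_diff)
  ultimately have "cmod (level_functional k (Inl i) A) \<le> 2 ^ k * c + norm (?B - A) * (1 + 2 ^ k * 2)"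
    by (simp add: algebra_simps)
  also have "\<dots> \<le> 2 ^ k * c + \<delta> * (1 + 2 ^ k * 2)"
    using l by (intro add_left_mono mult_right_mono) (auto simp: dist_norm)
  also have "\<delta> * (1 + 2 ^ k * 2) = e"
  proof -
    have "(1 + 2 ^ k * 2 :: real) \<noteq> 0" using add_pos_pos[of "1::real" "2 ^ k * 2"] by simp
    then show ?thesis by (simp add: \<delta>_def)
  qed
  finally show "cmod (level_functional k (Inl i) A) \<le> 2 ^ k * c + e" .
qed

definition level_norm :: "nat \<Rightarrow> (ell2 \<Rightarrow>\<^sub>L ell2) \<Rightarrow> real" where
  "level_norm k A = (SUP d. cmod (level_functional k d A))"

lemma bdd_above_level_functional: "bdd_above (range (\<lambda>d. cmod (level_functional k d A)))"
  using norm_level_functional_le by (auto intro!: bdd_aboveI2)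

lemma level_functional_le_level_norm: "cmod (level_functional k d A) \<le> level_norm k A"
  unfolding level_norm_def by (rule cSUP_upper[OF _ bdd_above_level_functional]) simp

lemma level_norm_le: "(\<And>d. cmod (level_functional k d A) \<le> c) \<Longrightarrow> level_norm k A \<le> c"
  unfolding level_norm_def by (rule cSUP_least) auto

lemma level_norm_nonneg: "0 \<le> level_norm k A"
  using level_functional_le_level_norm norm_ge_zero order_trans by blast

lemma level_norm_add_ge: "\<bar>level_norm k A - level_norm k B\<bar> \<le> level_norm k (A + B)"
proof -
  have *: "level_norm k A \<le> level_norm k (A + B) + level_norm k B" for A B
  proof (rule level_norm_le)
    fix d
    have "cmod (level_functional k d A)
        \<le> cmod (level_functional k d (A + B)) + cmod (level_functional k d B)"
      by (metis level_functional_add add_diff_cancel_right' norm_triangle_ineq4)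
    also have "\<dots> \<le> level_norm k (A + B) + level_norm k B"
      by (intro add_mono level_functional_le_level_norm)
    finally show "cmod (level_functional k d A) \<le> level_norm k (A + B) + level_norm k B" .
  qed
  show ?thesis using *[of A B] *[of B A] by (simp add: add.commute)
qed

text \<open>
  The lower \<open>\<ell>\<^sub>1\<close>-estimate over the levels: nearly norming functionals on the individual levels are
  rotated to have non-negative real values and combined into one test.
\<close>

lemma sum_level_norm_le:
  assumes A: "A \<in> l1_sum_space"
  shows "(\<Sum>k<K. level_norm k A) \<le> 4 * norm A"
proof -
  have "\<exists>d. level_norm k A / 2 \<le> cmod (level_functional k d A)" for k
  proof (cases "level_norm k A = 0")
    case False
    then have "level_norm k A / 2 < level_norm k A"
      using level_norm_nonneg[of k A] by simp
    then show ?thesis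
      unfolding level_norm_def less_cSUP_iff[OF UNIV_not_empty bdd_above_level_functional]
      using less_imp_le by blast
  qed simp
  then obtain d where d: "\<And>k. level_norm k A / 2 \<le> cmod (level_functional k (d k) A)"
    by metis
  have "\<forall>k. \<exists>m. cmod (level_functional k (d k) A) / 2
      \<le> Re (phase m * level_functional k (d k) A)"
    using ex_phase by blast
  from choice[OF this] obtain m where m: "\<And>k. cmod (level_functional k (d k) A) / 2
      \<le> Re (phase (m k) * level_functional k (d k) A)" by blast
  define \<tau> where "\<tau> = map (\<lambda>k. (m k, d k)) [0..<K]"
  have "(\<Sum>k<K. level_norm k A) / 4 = (\<Sum>k<K. level_norm k A / 2 / 2)"
    by (simp add: sum_divide_distrib)
  also have "\<dots> \<le> (\<Sum>k<K. Re (phase (m k) * level_functional k (d k) A))"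
    by (intro sum_mono order_trans[OF divide_right_mono[OF d] m]) simp
  also have "\<dots> = Re (diag_entry A (to_nat \<tau>))"
    using A by (simp add: diag_entry_l1_sum_space[OF A from_nat_to_nat] \<tau>_def)
  also have "\<dots> \<le> norm A" using complex_Re_le_cmod cmod_diag_entry_le order_trans by blast
  finally show ?thesis by simp
qed

lemma norm_le_sum_level_norm:
  assumes A: "A \<in> l1_sum_space" and c: "\<And>K. (\<Sum>k<K. level_norm k A) \<le> c"
  shows "norm A \<le> c"
proof (rule norm_diag_le[OF is_diag_l1_sum_space[OF A]])
  fix t
  define \<tau> :: "(nat \<times> (nat + nat list)) list" where "\<tau> = from_nat t"
  have "cmod (diag_entry A t) \<le> (\<Sum>k<length \<tau>. level_norm k A)"
    unfolding diag_entry_l1_sum_space[OF A \<tau>_def[symmetric]]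
  proof (rule sum_norm_le)
    fix k
    have "cmod (phase (fst (\<tau> ! k)) * level_functional k (snd (\<tau> ! k)) A) \<le> 1 * level_norm k A"
      unfolding norm_mult
      by (intro mult_mono norm_phase_le level_functional_le_level_norm) auto
    then show "cmod (phase (fst (\<tau> ! k)) * level_functional k (snd (\<tau> ! k)) A) \<le> level_norm k A"
      by simp
  qed
  also have "\<dots> \<le> c" by (rule c)
  finally show "cmod (diag_entry A t) \<le> c" .
qed


section \<open>Operators from the first space to the second\<close>

lemma bounded_clinear_on_sum:
  assumes T: "bounded_clinear_on (gen_space b) T" and A: "\<And>i. i \<in> I \<Longrightarrow> A i \<in> gen_space b"
  shows "T (\<Sum>i\<in>I. scale_op (c i) (A i)) = (\<Sum>i\<in>I. scale_op (c i) (T (A i)))"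
  using A
proof (induction I rule: infinite_finite_induct)
  case (insert i I)
  then show ?case
    using T by (simp add: bounded_clinear_on_def gen_space_sum gen_space_scale)
next
  case empty
  have "T (scale_op 0 0) = scale_op 0 (T 0)"
    using T gen_space_0 unfolding bounded_clinear_on_def by blast
  then show ?case by simp
next
  case (infinite I)
  have "T (scale_op 0 0) = scale_op 0 (T 0)"
    using T gen_space_0 unfolding bounded_clinear_on_def by blast
  then show ?case using infinite by simp
qed

lemma norm_sum_c0_gen_le:
  assumes "\<And>i. cmod (c i) \<le> 1"
  shows "norm (\<Sum>i\<in>F. scale_op (c i) (c0_gen i)) \<le> 1"
proof (rule norm_diag_le)
  show "is_diag (\<Sum>i\<in>F. scale_op (c i) (c0_gen i))"
    by (intro is_diag_c0_space)
      (auto simp: c0_space_def intro!: gen_space_sum gen_space_scale gen_space_generator)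
  fix t
  show "cmod (diag_entry (\<Sum>i\<in>F. scale_op (c i) (c0_gen i)) t) \<le> 1"
  proof (cases "finite F")
    case True
    then show ?thesis
      using assms by (simp add: diag_entry_sum diag_entry_scale diag_entry_c0_gen
          if_distrib[of "(*) _"] cong: if_cong)
  qed simp
qed

lemma norm_c0_gen: "norm (c0_gen i) = 1"
proof (rule antisym)
  show "norm (c0_gen i) \<le> 1" using norm_sum_c0_gen_le[of "\<lambda>_. 1" "{i}"] by simp
  show "1 \<le> norm (c0_gen i)"
    using cmod_diag_entry_le[of "c0_gen i" i] by (simp add: diag_entry_c0_gen)
qed

text \<open>
  Choosing the multipliers to cancel the arguments of the \<open>z i\<close> shows that \<open>z\<close> is absolutely summable.
\<close>

lemma null_of_bounded_sums:
  fixes z :: "nat \<Rightarrow> complex"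
  assumes "\<And>n c. (\<And>i. cmod (c i) \<le> 1) \<Longrightarrow> cmod (\<Sum>i<n. c i * z i) \<le> C"
  shows "z \<longlonglongrightarrow> 0"
proof -
  have "(\<Sum>i<n. cmod (z i)) \<le> C" for n
  proof -
    have "(\<Sum>i<n. cnj (sgn (z i)) * z i) = (\<Sum>i<n. complex_of_real (cmod (z i)))"
    proof (rule sum.cong[OF refl])
      fix i
      have "z i * cnj (z i) = complex_of_real (cmod (z i)) * complex_of_real (cmod (z i))"
        by (simp add: complex_norm_square[symmetric] power2_eq_square)
      then show "cnj (sgn (z i)) * z i = complex_of_real (cmod (z i))"
        by (simp add: sgn_eq mult.commute divide_eq_eq)
    qed
    also have "\<dots> = complex_of_real (\<Sum>i<n. cmod (z i))" by simp
    finally have "cmod (\<Sum>i<n. cnj (sgn (z i)) * z i) = (\<Sum>i<n. cmod (z i))"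
      by (simp only: norm_of_real) (simp add: sum_nonneg)
    then show ?thesis
      using assms[of "\<lambda>i. cnj (sgn (z i))" n] by (simp add: norm_sgn)
  qed
  then have "summable (\<lambda>i. cmod (z i))" by (intro summableI_nonneg_bounded) auto
  then show ?thesis using summable_LIMSEQ_zero tendsto_norm_zero_iff by blast
qed

text \<open>
  Every level is isomorphic to \<open>\<ell>\<^sub>1\<close>, and the whole space is an \<open>\<ell>\<^sub>1\<close>-sum of levels. An operator from
  \<open>c\<^sub>0\<close> has bounded sums of images of unit vectors, so their coefficients tend to \<open>0\<close>. The gliding hump
  over the coefficients of one level turns this into convergence of each level norm, and the gliding
  hump over the levels into convergence of the norm. The two scales have to be separated since the
  isomorphism constants of the levels are unbounded.
\<close>

lemma c0_to_l1_sum_null: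
  assumes T: "bounded_clinear_on c0_space T" and range: "T \<in> c0_space \<rightarrow> l1_sum_space" and "\<eta> > 0"
  shows "\<forall>\<^sub>F i in sequentially. norm (T (c0_gen i)) \<le> \<eta>"
proof -
  define u where "u = (\<lambda>i. T (c0_gen i))"
  have gen: "c0_gen i \<in> c0_space" for i by (simp add: c0_space_def gen_space_generator)
  have u: "u i \<in> l1_sum_space" for i using range gen by (auto simp: u_def)
  have uF: "(\<Sum>i\<in>F. u i) \<in> l1_sum_space" for F
    using u unfolding l1_sum_space_def by (intro gen_space_sum)
  obtain C where C: "\<And>A. A \<in> c0_space \<Longrightarrow> norm (T A) \<le> C * norm A"
    using T unfolding bounded_clinear_on_def by blast
  have "0 \<le> C" using order_trans[OF norm_ge_zero C[OF gen[of 0]]] by (simp add: norm_c0_gen)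
  have bound: "norm (\<Sum>i\<in>F. scale_op (c i) (u i)) \<le> C" if c: "\<And>i. cmod (c i) \<le> 1" for c F
  proof -
    have "(\<Sum>i\<in>F. scale_op (c i) (u i)) = T (\<Sum>i\<in>F. scale_op (c i) (c0_gen i))"
      unfolding u_def
      by (rule bounded_clinear_on_sum[symmetric]) (use T gen in \<open>auto simp: c0_space_def\<close>)
    also have "norm \<dots> \<le> C * norm (\<Sum>i\<in>F. scale_op (c i) (c0_gen i))"
    proof (rule C)
      show "(\<Sum>i\<in>F. scale_op (c i) (c0_gen i)) \<in> c0_space"
        unfolding c0_space_def by (intro gen_space_sum gen_space_scale gen_space_generator)
    qed
    also have "\<dots> \<le> C" using norm_sum_c0_gen_le[where F = F, OF c] \<open>0 \<le> C\<close> by (simp add: mult_left_le)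
    finally show ?thesis .
  qed
  have boundF: "norm (\<Sum>i\<in>F. u i) \<le> C" for F using bound[where c = "\<lambda>_. 1" and F = F] by simp
  have coord_null: "(\<lambda>i. cmod (coord k s (u i))) \<longlonglongrightarrow> 0" for k s
  proof -
    have "(\<lambda>i. coord k s (u i)) \<longlonglongrightarrow> 0"
    proof (rule null_of_bounded_sums)
      fix n and c :: "nat \<Rightarrow> complex" assume "\<And>i. cmod (c i) \<le> 1"
      then show "cmod (\<Sum>i<n. c i * coord k s (u i)) \<le> C"
        using order_trans[OF norm_level_functional_le[of k _ "\<Sum>i<n. scale_op (c i) (u i)"] bound]
        by (simp add: coord_def level_functional_sum level_functional_scale)
    qed
    then show ?thesis by (rule tendsto_norm_zero)
  qed
  have level_small: "\<forall>\<^sub>F i in sequentially. \<forall>S. (\<Sum>s<S. cmod (coord k s (u i))) \<le> \<epsilon>"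
    if "\<epsilon> > 0" for k \<epsilon>
  proof -
    have "\<forall>\<^sub>F i in sequentially. \<forall>S. (\<Sum>s<S. cmod (coord k s (\<Sum>j\<in>{i}. u j))) \<le> \<epsilon>"
    proof (rule gliding_hump[where C = "2 * C"])
      show "(\<Sum>s<S. cmod (coord k s (\<Sum>j\<in>F. u j))) \<le> 2 * C" for F S
        using sum_coord_le[OF uF[of F], of k S] boundF[of F] by simp
      show "\<bar>cmod (coord k s (\<Sum>j\<in>F. u j)) - cmod (coord k s (\<Sum>j\<in>{i}. u j))\<bar>
          \<le> cmod (coord k s (\<Sum>j\<in>insert i F. u j))" if "finite F" "i \<notin> F" for s F i
        using that norm_triangle_ineq3[of "coord k s (\<Sum>j\<in>F. u j)" "- coord k s (u i)"]
        by (simp add: coord_add add.commute)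
    qed (use coord_null that in auto)
    then show ?thesis by simp
  qed
  have level_null: "(\<lambda>i. level_norm k (u i)) \<longlonglongrightarrow> 0" for k
  proof (rule tendstoI)
    fix e :: real assume "e > 0"
    then have "\<forall>\<^sub>F i in sequentially. \<forall>S. (\<Sum>s<S. cmod (coord k s (u i))) \<le> e / 2 / 2 ^ k"
      by (intro level_small) simp
    then show "\<forall>\<^sub>F i in sequentially. dist (level_norm k (u i)) 0 < e"
    proof (rule eventually_mono)
      fix i assume le: "\<forall>S. (\<Sum>s<S. cmod (coord k s (u i))) \<le> e / 2 / 2 ^ k"
      have "level_norm k (u i) \<le> e / 2"
      proof (rule level_norm_le)
        fix d
        show "cmod (level_functional k d (u i)) \<le> e / 2"
        proof (cases d)
          case (Inl j)
          show ?thesis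
            using norm_level_functional_Inl_le[OF u le[rule_format], of j] by (simp add: Inl)
        next
          case (Inr \<sigma>)
          have "cmod (level_functional k d (u i)) \<le> (\<Sum>s<length \<sigma>. cmod (coord k s (u i)))"
            unfolding Inr level_functional_Inr[OF u]
          proof (rule sum_norm_le)
            show "cmod (phase (\<sigma> ! s) * coord k s (u i)) \<le> cmod (coord k s (u i))" for s
              by (simp add: norm_mult mult_left_le_one_le norm_phase_le)
          qed
          also have "\<dots> \<le> e / 2 / 2 ^ k" using le by blast
          also have "\<dots> \<le> e / 2" using \<open>e > 0\<close> by (simp add: divide_le_eq mult_le_cancel_left1)
          finally show ?thesis .
        qed
      qed
      then show "dist (level_norm k (u i)) 0 < e"
        using \<open>e > 0\<close> level_norm_nonneg[of k "u i"] by simp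
    qed
  qed
  have "\<forall>\<^sub>F i in sequentially. \<forall>K. (\<Sum>k<K. level_norm k (\<Sum>j\<in>{i}. u j)) \<le> \<eta>"
  proof (rule gliding_hump[where C = "4 * C"])
    show "(\<Sum>k<K. level_norm k (\<Sum>j\<in>F. u j)) \<le> 4 * C" for F K
      using sum_level_norm_le[OF uF[of F], of K] boundF[of F] by simp
    show "\<bar>level_norm k (\<Sum>j\<in>F. u j) - level_norm k (\<Sum>j\<in>{i}. u j)\<bar>
        \<le> level_norm k (\<Sum>j\<in>insert i F. u j)" if "finite F" "i \<notin> F" for k F i
      using that level_norm_add_ge[of k "\<Sum>j\<in>F. u j" "u i"] by (simp add: add.commute)
  qed (use level_null level_norm_nonneg \<open>\<eta> > 0\<close> in auto)
  then show ?thesis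
    by (rule eventually_mono) (use norm_le_sum_level_norm[OF u] in \<open>simp add: u_def\<close>)
qed

lemma c0_space_not_embeds: "\<not> isomorphically_embeds c0_space l1_sum_space"
proof
  assume "isomorphically_embeds c0_space l1_sum_space"
  then obtain T where T: "T \<in> c0_space \<rightarrow> l1_sum_space" "bounded_clinear_on c0_space T"
    and inj: "inj_on T c0_space"
    and inv: "bounded_clinear_on (T ` c0_space) (inv_into c0_space T)"
    unfolding isomorphically_embeds_def by blast
  have "\<exists>K. \<forall>B\<in>T ` c0_space. norm (inv_into c0_space T B) \<le> K * norm B"
    using inv by (simp only: bounded_clinear_on_def)
  then obtain K where K: "\<forall>B\<in>T ` c0_space. norm (inv_into c0_space T B) \<le> K * norm B" ..
  have lower: "1 \<le> K * norm (T (c0_gen i))" for i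
  proof -
    have gen: "c0_gen i \<in> c0_space" by (simp add: c0_space_def gen_space_generator)
    show ?thesis using bspec[OF K imageI[OF gen]] by (simp add: inv_into_f_f[OF inj gen] norm_c0_gen)
  qed
  have "K > 0"
    using lower[of 0] mult_nonpos_nonneg[OF _ norm_ge_zero[of "T (c0_gen 0)"], of K]
    by (cases "K \<le> 0") simp_all
  then have "\<forall>\<^sub>F i in sequentially. norm (T (c0_gen i)) \<le> 1 / (2 * K)"
    by (intro c0_to_l1_sum_null T) simp
  then obtain i where "norm (T (c0_gen i)) \<le> 1 / (2 * K)"
    using eventually_happens'[OF sequentially_bot] by blast
  then have "K * norm (T (c0_gen i)) \<le> 1 / 2" using \<open>K > 0\<close> by (simp add: field_simps)
  then show False using lower[of i] by simp
qed


section \<open>A radial partition of unity\<close>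

text \<open>
  The ramp rises linearly from \<open>0\<close> to \<open>1\<close> on the dyadic interval from \<open>2 ^ k\<close> to \<open>2 ^ Suc k\<close>. Written as
  a difference of truncations, the ramps multiplied by their lengths telescope.
\<close>

definition ramp :: "nat \<Rightarrow> real \<Rightarrow> real" where
  "ramp k r = (min r (2 ^ Suc k) - min r (2 ^ k)) / 2 ^ k"

definition radial_weight :: "nat \<Rightarrow> real \<Rightarrow> real" where
  "radial_weight k r = (case k of 0 \<Rightarrow> 1 | Suc j \<Rightarrow> ramp j r) - ramp k r"

lemma ramp_scale:
  obtains a where "a > 0" "2 ^ k = a" "\<And>r. ramp k r = (min r (2 * a) - min r a) / a"
  using that[of "2 ^ k"] by (simp add: ramp_def)

lemma ramp_eq_0: "r \<le> 2 ^ k \<Longrightarrow> ramp k r = 0"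
  by (rule ramp_scale[of k]) (auto simp: min_def)

lemma ramp_eq_1: "2 ^ Suc k \<le> r \<Longrightarrow> ramp k r = 1"
  by (rule ramp_scale[of k]) (auto simp: min_def)

lemma ramp_nonneg: "0 \<le> ramp k r"
  by (rule ramp_scale[of k]) (auto simp: min_def)

lemma ramp_le_1: "ramp k r \<le> 1"
  by (rule ramp_scale[of k]) (auto simp: min_def divide_le_eq)

lemma ramp_mono: "s \<le> r \<Longrightarrow> ramp k s \<le> ramp k r"
  by (rule ramp_scale[of k]) (auto simp: min_def intro!: divide_right_mono)

lemma radial_weight_nonneg: "0 \<le> radial_weight k r"
proof (cases k)
  case 0
  then show ?thesis using ramp_le_1 by (simp add: radial_weight_def)
next
  case (Suc j)
  show ?thesis
  proof (cases "2 ^ Suc j \<le> r")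
    case True
    then show ?thesis using ramp_le_1[of k r] by (simp add: radial_weight_def Suc ramp_eq_1)
  next
    case False
    then show ?thesis using ramp_nonneg[of j r] by (simp add: radial_weight_def Suc ramp_eq_0)
  qed
qed

lemma radial_weight_support:
  assumes "radial_weight k r \<noteq> 0"
  shows "r \<le> 2 ^ Suc k"
proof (rule ccontr)
  assume "\<not> r \<le> 2 ^ Suc k"
  then have "2 ^ Suc k \<le> r" by simp
  moreover from this have "2 ^ k \<le> r" by (rule order_trans[rotated]) simp
  ultimately have "radial_weight k r = 0"
    by (auto simp: radial_weight_def ramp_eq_1 split: nat.split)
  with assms show False by simp
qed

lemma sum_radial_weight: "(\<Sum>k<Suc K. radial_weight k r) = 1 - ramp K r"
  by (induction K) (simp_all add: radial_weight_def)

lemma sum_radial_weight_le: "(\<Sum>k<K. radial_weight k r) \<le> 1"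
  using ramp_nonneg by (cases K) (simp_all add: sum_radial_weight del: sum.lessThan_Suc)

lemma radial_weight_eq_0:
  assumes "r \<le> 2 ^ K" "K < k"
  shows "radial_weight k r = 0"
proof -
  obtain j where k: "k = Suc j" "K \<le> j" using assms(2) by (cases k) auto
  have "(2::real) ^ K \<le> 2 ^ j" "(2::real) ^ K \<le> 2 ^ Suc j"
    using k(2) by (intro power_increasing; simp)+
  then have "r \<le> 2 ^ j" "r \<le> 2 ^ Suc j" using assms(1) by linarith+
  then show ?thesis by (simp add: radial_weight_def k(1) ramp_eq_0 del: power_Suc)
qed

text \<open>
  The weights vary slowly on the logarithmic scale: transporting a vector of norm \<open>s\<close> from the weights
  of \<open>s\<close> to those of \<open>r\<close> costs at most a multiple of \<open>r - s\<close>. Indeed \<open>s\<close> may be replaced by \<open>2 ^ Suc k\<close> in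
  front of an increment of the \<open>k\<close>-th ramp, as this increment vanishes when \<open>2 ^ Suc k \<le> s\<close>; the sum of
  the increments then telescopes.
\<close>

lemma radial_weight_variation:
  assumes "0 \<le> s" "s \<le> r"
  shows "(\<Sum>k<K. \<bar>radial_weight k r - radial_weight k s\<bar>) * s \<le> 4 * (r - s)"
proof -
  let ?D = "\<lambda>k. \<bar>ramp k r - ramp k s\<bar>"
  have "(\<Sum>k<Suc K. \<bar>radial_weight k r - radial_weight k s\<bar>) \<le> (\<Sum>k<K. ?D k) + (\<Sum>k<Suc K. ?D k)"
  proof (induction K)
    case (Suc K)
    have "\<bar>radial_weight (Suc K) r - radial_weight (Suc K) s\<bar> \<le> ?D K + ?D (Suc K)"
      by (simp add: radial_weight_def)
    then show ?case using Suc by simp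
  qed (simp add: radial_weight_def)
  moreover have "(\<Sum>k<K. \<bar>radial_weight k r - radial_weight k s\<bar>)
      \<le> (\<Sum>k<Suc K. \<bar>radial_weight k r - radial_weight k s\<bar>)" by simp
  moreover have "(\<Sum>k<K. ?D k) \<le> (\<Sum>k<Suc K. ?D k)" by simp
  ultimately have "(\<Sum>k<K. \<bar>radial_weight k r - radial_weight k s\<bar>) \<le> 2 * (\<Sum>k<Suc K. ?D k)"
    by linarith
  from mult_right_mono[OF this assms(1)]
  have "(\<Sum>k<K. \<bar>radial_weight k r - radial_weight k s\<bar>) * s \<le> 2 * (\<Sum>k<Suc K. ?D k * s)"
    by (simp only: sum_distrib_right mult.assoc)
  also have "(\<Sum>k<Suc K. ?D k * s)
      \<le> (\<Sum>k<Suc K. 2 * ((min r (2 ^ Suc k) - min s (2 ^ Suc k)) - (min r (2 ^ k) - min s (2 ^ k))))"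
  proof (rule sum_mono)
    fix k
    have "?D k * s \<le> (ramp k r - ramp k s) * 2 ^ Suc k"
    proof (cases "s \<le> 2 ^ Suc k")
      case True
      then show ?thesis using ramp_mono[OF assms(2), of k] by (simp add: mult_left_mono)
    next
      case False
      then show ?thesis using assms(2) by (simp add: ramp_eq_1)
    qed
    also have "\<dots> = 2 * ((min r (2 ^ Suc k) - min s (2 ^ Suc k)) - (min r (2 ^ k) - min s (2 ^ k)))"
      by (simp add: ramp_def diff_divide_distrib[symmetric])
    finally show "?D k * s
        \<le> 2 * ((min r (2 ^ Suc k) - min s (2 ^ Suc k)) - (min r (2 ^ k) - min s (2 ^ k)))" .
  qed
  also have "\<dots> = 2 * ((min r (2 ^ Suc K) - min s (2 ^ Suc K)) - (min r 1 - min s 1))"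
    unfolding sum_distrib_left[symmetric]
    by (subst sum_lessThan_telescope) simp
  also have "\<dots> \<le> 2 * (r - s)" using assms(2) by (simp add: min_def)
  finally show ?thesis by simp
qed

text \<open>
  Matrices of size \<open>n\<close> start at level \<open>n\<close>, so that the factor \<open>2 powr (- n)\<close> in the level weights beats
  the factor \<open>n\<close> in passing from entries to matrices.
\<close>

definition shifted_weight :: "nat \<Rightarrow> nat \<Rightarrow> real \<Rightarrow> real" where
  "shifted_weight n l r = (if n \<le> l then radial_weight (l - n) r else 0)"

lemma shifted_weight_nonneg: "0 \<le> shifted_weight n l r"
  by (simp add: shifted_weight_def radial_weight_nonneg)

lemma sum_shifted:
  fixes n L :: nat
  shows "(\<Sum>l<L. if n \<le> l then g (l - n) else 0) = (\<Sum>k<L - n. g k :: real)"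
  by (induction L) (auto simp: Suc_diff_le)

lemma sum_shifted_weight: "(\<Sum>l<L. shifted_weight n l r) = (\<Sum>k<L - n. radial_weight k r)"
  unfolding shifted_weight_def by (rule sum_shifted)

lemma shifted_weight_variation:
  assumes "0 \<le> s" "s \<le> r"
  shows "(\<Sum>l<L. \<bar>shifted_weight n l r - shifted_weight n l s\<bar> * s) \<le> 4 * (r - s)"
proof -
  have "(\<Sum>l<L. \<bar>shifted_weight n l r - shifted_weight n l s\<bar>)
      = (\<Sum>l<L. if n \<le> l then \<bar>radial_weight (l - n) r - radial_weight (l - n) s\<bar> else 0)"
    by (rule sum.cong) (auto simp: shifted_weight_def)
  also have "\<dots> = (\<Sum>k<L - n. \<bar>radial_weight k r - radial_weight k s\<bar>)" by (rule sum_shifted)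
  finally show ?thesis
    using radial_weight_variation[OF assms, of "L - n"] by (simp add: sum_distrib_right[symmetric])
qed


section \<open>Layer cake maps\<close>

text \<open>
  The four non-negative parts of a complex number: positive and negative parts of the real and of the
  imaginary part, indexed by the power of \<open>\<i>\<close> that multiplies them.
\<close>

definition quadrant_part :: "nat \<Rightarrow> complex \<Rightarrow> real" where
  "quadrant_part m z = max 0 (Re (z * (- \<i>) ^ m))"

lemma sum_quadrant_part: "(\<Sum>m<4. \<i> ^ m * complex_of_real (quadrant_part m z)) = z"
  by (simp add: quadrant_part_def numeral_eq_Suc complex_eq_iff max_def)

lemma quadrant_part_nonneg: "0 \<le> quadrant_part m z"
  by (simp add: quadrant_part_def)

lemma quadrant_part_le: "quadrant_part m z \<le> cmod z"
  using complex_Re_le_cmod[of "z * (- \<i>) ^ m"]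
  by (simp add: quadrant_part_def norm_mult norm_power)

definition level_set :: "nat \<Rightarrow> nat \<Rightarrow> nat \<Rightarrow> (ell2 \<Rightarrow>\<^sub>L ell2) \<Rightarrow> nat set" where
  "level_set n m t x = {i. real (Suc t) / n \<le> quadrant_part m (diag_entry x i)}"

lemma finite_level_set:
  assumes "x \<in> c0_space" "1 \<le> n"
  shows "finite (level_set n m t x)"
proof (rule finite_subset)
  show "level_set n m t x \<subseteq> {i. real (Suc t) / n \<le> cmod (diag_entry x i)}"
    using quadrant_part_le order_trans by (fastforce simp: level_set_def)
  show "finite {i. real (Suc t) / n \<le> cmod (diag_entry x i)}"
    by (rule c0_space_entries_finite[OF assms(1)]) (use assms(2) in simp)
qed

text \<open>
  The sum counts the grid points \<open>1 / n, 2 / n, \<dots>\<close> that do not exceed \<open>p\<close>, that is, it rounds \<open>p\<close> down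
  to the grid.
\<close>

lemma layer_cake:
  fixes p :: real and n :: nat
  assumes "0 \<le> p" "p \<le> real N / n" "1 \<le> n"
  shows "\<bar>(\<Sum>t<N. of_bool (real (Suc t) / n \<le> p) / n) - p\<bar> \<le> 1 / n"
proof -
  have np: "0 \<le> p * n" "p * n \<le> N" using assms by (auto simp: field_simps)
  have "(\<Sum>t<N. of_bool (real (Suc t) / n \<le> p) / n) = (\<Sum>t<N. of_bool (real (Suc t) / n \<le> p)) / n"
    by (rule sum_divide_distrib[symmetric])
  also have "(\<Sum>t<N. of_bool (real (Suc t) / n \<le> p)) = (\<Sum>t<nat \<lfloor>p * n\<rfloor>. 1 :: real)"
  proof (rule sum.mono_neutral_cong_right)
    show "{..<nat \<lfloor>p * n\<rfloor>} \<subseteq> {..<N}"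
      using np by (auto simp: nat_less_iff floor_less_iff less_le_trans) linarith
    show "\<forall>t\<in>{..<N} - {..<nat \<lfloor>p * n\<rfloor>}. of_bool (real (Suc t) / n \<le> p) = (0 :: real)"
      using assms(3) np by (auto simp: field_simps) linarith
    show "of_bool (real (Suc t) / n \<le> p) = (1 :: real)" if "t \<in> {..<nat \<lfloor>p * n\<rfloor>}" for t
      using assms(3) that by (auto simp: field_simps) linarith
  qed simp
  also have "\<dots> = of_int \<lfloor>p * n\<rfloor>" using np by simp
  finally have "(\<Sum>t<N. of_bool (real (Suc t) / n \<le> p) / n) - p = (of_int \<lfloor>p * n\<rfloor> - p * n) / n"
    using assms(3) by (simp add: field_simps)
  moreover have "\<bar>of_int \<lfloor>p * n\<rfloor> - p * n\<bar> \<le> 1" by linarith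
  ultimately show ?thesis using assms(3) by (simp add: divide_right_mono)
qed

text \<open>
  A non-linear right inverse of the quotient map on level \<open>l\<close>, up to the grid size \<open>1 / n\<close>: a
  non-negative sequence with values up to \<open>N / n\<close> is, up to rounding, the average of the indicator
  functions of its superlevel sets, multiplied by \<open>N / n\<close>. The \<open>\<ell>\<^sub>1\<close>-norm of the representation is at
  most \<open>4 * N / n\<close>. Superlevel sets of null sequences are
  finite, hence have codes.
\<close>

definition layers :: "nat \<Rightarrow> nat \<Rightarrow> nat \<Rightarrow> (ell2 \<Rightarrow>\<^sub>L ell2) \<Rightarrow> ell2 \<Rightarrow>\<^sub>L ell2" where
  "layers l n N x =
     (\<Sum>t<N. \<Sum>m<4. scale_op (\<i> ^ m / n) (l1_gen (l, set_encode (level_set n m t x))))"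

lemma layers_in_l1_sum_space: "layers l n N x \<in> l1_sum_space"
  unfolding layers_def l1_sum_space_def by (intro gen_space_sum gen_space_scale gen_space_generator)

lemma level_functional_layers_other: "l \<noteq> k \<Longrightarrow> level_functional k d (layers l n N x) = 0"
  by (simp add: layers_def level_functional_sum level_functional_scale level_functional_l1_gen)

lemma level_functional_layers_Inl:
  assumes x: "x \<in> c0_space" and n: "1 \<le> n" and N: "cmod (diag_entry x i) \<le> real N / n"
  shows "cmod (level_functional l (Inl i) (layers l n N x) - diag_entry x i) \<le> 4 / n"
proof -
  let ?z = "diag_entry x i"
  let ?S = "\<lambda>m. \<Sum>t<N. of_bool (real (Suc t) / n \<le> quadrant_part m ?z) / real n"
  have "level_functional l (Inl i) (layers l n N x)
      = (\<Sum>t<N. \<Sum>m<4. \<i> ^ m * complex_of_real (of_bool (real (Suc t) / n \<le> quadrant_part m ?z) / n))"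
    unfolding layers_def level_functional_sum level_functional_scale level_functional_l1_gen
    by (simp add: set_encode_inverse[OF finite_level_set[OF x n]]) (simp add: level_set_def of_bool_def if_distrib[of complex_of_real]
        cong: if_cong)
  also have "\<dots> = (\<Sum>m<4. \<i> ^ m * complex_of_real (?S m))"
    by (subst sum.swap) (simp add: sum_distrib_left)
  finally have "level_functional l (Inl i) (layers l n N x) - ?z
      = (\<Sum>m<4. \<i> ^ m * complex_of_real (?S m)) - (\<Sum>m<4. \<i> ^ m * complex_of_real (quadrant_part m ?z))"
    by (simp only: sum_quadrant_part)
  also have "\<dots> = (\<Sum>m<4. \<i> ^ m * complex_of_real (?S m - quadrant_part m ?z))"
    by (simp only: sum_subtractf[symmetric] right_diff_distrib[symmetric] of_real_diff[symmetric])
  finally have "cmod (level_functional l (Inl i) (layers l n N x) - ?z)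
      = cmod (\<Sum>m<4. \<i> ^ m * complex_of_real (?S m - quadrant_part m ?z))" by simp
  also have "\<dots> \<le> (\<Sum>m<(4::nat). 1 / n)"
  proof (rule sum_norm_le)
    fix m
    have "\<bar>?S m - quadrant_part m ?z\<bar> \<le> 1 / n"
      by (intro layer_cake quadrant_part_nonneg n order_trans[OF quadrant_part_le N])
    then show "cmod (\<i> ^ m * complex_of_real (?S m - quadrant_part m ?z)) \<le> 1 / n"
      by (simp only: norm_mult norm_power norm_ii power_one mult_1 norm_of_real)
  qed
  also have "\<dots> = 4 / n" by simp
  finally show ?thesis .
qed

lemma level_functional_layers_Inr:
  "cmod (level_functional l (Inr \<sigma>) (layers l n N x)) \<le> real N * 4 / n * (1 / 2) ^ l"
proof -
  have w: "cmod (level_weight l (Inr \<sigma>) s) \<le> (1 / 2) ^ l" for s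
    using norm_phase_le by (simp add: norm_mult norm_power norm_divide mult_left_le)
  have "cmod (level_functional l (Inr \<sigma>) (layers l n N x))
      \<le> (\<Sum>t<N. \<Sum>m<(4::nat). 1 / n * (1 / 2) ^ l)"
    unfolding layers_def level_functional_sum
  proof (intro sum_norm_le)
    fix t m
    have "cmod (level_functional l (Inr \<sigma>)
        (scale_op (\<i> ^ m / n) (l1_gen (l, set_encode (level_set n m t x)))))
        = 1 / n * cmod (level_weight l (Inr \<sigma>) (set_encode (level_set n m t x)))"
      by (simp add: level_functional_scale level_functional_l1_gen norm_mult norm_divide norm_power
          del: level_weight.simps)
    also have "\<dots> \<le> 1 / n * (1 / 2) ^ l" by (intro mult_left_mono w) simp
    finally show "cmod (level_functional l (Inr \<sigma>)
        (scale_op (\<i> ^ m / n) (l1_gen (l, set_encode (level_set n m t x))))) \<le> 1 / n * (1 / 2) ^ l" .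
  qed
  then show ?thesis by simp
qed


section \<open>The spherical amplifications\<close>

text \<open>
  The map for matrices of size \<open>n\<close> on the sphere of radius \<open>r\<close>. It lifts \<open>x\<close> to the levels that are
  active at radius \<open>r\<close>. The number of layers is chosen so that the grid \<open>1 / n\<close> covers all entries of
  modulus at most \<open>r\<close>, and the sum reaches all levels of non-zero weight.
\<close>

definition sphere_map :: "nat \<Rightarrow> real \<Rightarrow> (ell2 \<Rightarrow>\<^sub>L ell2) \<Rightarrow> ell2 \<Rightarrow>\<^sub>L ell2" where
  "sphere_map n r x = (\<Sum>k\<le>nat \<lceil>r\<rceil>.
     scale_op (radial_weight k r) (layers (k + n) n (nat \<lceil>n * r\<rceil>) x))"

lemma sphere_map_in_l1_sum_space: "sphere_map n r x \<in> l1_sum_space"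
  unfolding sphere_map_def l1_sum_space_def
  by (intro gen_space_sum gen_space_scale layers_in_l1_sum_space[unfolded l1_sum_space_def])

lemma le_two_power_ceiling: "(r :: real) \<le> 2 ^ nat \<lceil>r\<rceil>"
proof -
  have "r \<le> real (nat \<lceil>r\<rceil>)" by linarith
  also have "\<dots> \<le> 2 ^ nat \<lceil>r\<rceil>" using of_nat_less_two_power less_imp_le by blast
  finally show ?thesis .
qed

lemma level_functional_sphere_map:
  "level_functional l d (sphere_map n r x)
    = shifted_weight n l r * level_functional l d (layers l n (nat \<lceil>n * r\<rceil>) x)"
proof -
  have "level_functional l d (sphere_map n r x)
      = (\<Sum>k\<le>nat \<lceil>r\<rceil>. if k + n = l
          then radial_weight k r * level_functional l d (layers l n (nat \<lceil>n * r\<rceil>) x) else 0)"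
    by (auto simp: sphere_map_def level_functional_sum level_functional_scale
        level_functional_layers_other intro!: sum.cong)
  also have "\<dots> = shifted_weight n l r * level_functional l d (layers l n (nat \<lceil>n * r\<rceil>) x)"
  proof (cases "n \<le> l")
    case True
    then have "k + n = l \<longleftrightarrow> k = l - n" for k by auto
    then show ?thesis
      using True radial_weight_eq_0[OF le_two_power_ceiling[of r], of "l - n"]
      by (auto simp: shifted_weight_def)
  next
    case False
    then show ?thesis by (auto simp: shifted_weight_def)
  qed
  finally show ?thesis .
qed

text \<open>
  What a level functional would give on an exact linear lifting of \<open>x\<close> whose \<open>\<ell>\<^sub>1\<close>-part is negligible.
\<close>

fun level_target :: "nat + nat list \<Rightarrow> (ell2 \<Rightarrow>\<^sub>L ell2) \<Rightarrow> complex" where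
  "level_target (Inl i) x = diag_entry x i"
| "level_target (Inr \<sigma>) x = 0"

text \<open>
  On the coordinates of the quotient the error comes from rounding. On the \<open>\<ell>\<^sub>1\<close>-part the value
  itself is small: the lifting has \<open>\<ell>\<^sub>1\<close>-norm of order \<open>r + 1\<close> with \<open>r \<le> 2 ^ Suc k\<close> at level \<open>l = k + n\<close>, where the weight
  of the \<open>\<ell>\<^sub>1\<close>-norm is \<open>2 powr (- k - n)\<close>. So every functional of the second space sees the non-linear
  lifting as linear, up to an error of order \<open>1 / n\<close>.
\<close>

lemma level_functional_sphere_map_approx:
  assumes x: "x \<in> c0_space" and n: "1 \<le> n" and r: "\<And>i. cmod (diag_entry x i) \<le> r"
  shows "cmod (level_functional l d (sphere_map n r x) - shifted_weight n l r * level_target d x)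
    \<le> shifted_weight n l r * (12 / n)"
proof -
  let ?N = "nat \<lceil>n * r\<rceil>"
  have r0: "0 \<le> r" using r[of 0] norm_ge_zero order_trans by blast
  have N: "r \<le> real ?N / n" "real ?N / n \<le> r + 1"
  proof -
    have "n * r \<le> real ?N" by linarith
    then show "r \<le> real ?N / n" using n by (simp add: field_simps)
    have "0 \<le> n * r" using r0 by simp
    then have "real ?N \<le> n * r + 1" by linarith
    also have "\<dots> \<le> n * (r + 1)" using n by (simp add: algebra_simps)
    finally show "real ?N / n \<le> r + 1" using n by (simp add: field_simps)
  qed
  have bound: "cmod (level_functional l d (layers l n ?N x) - level_target d x) \<le> 12 / n"
    if w: "shifted_weight n l r \<noteq> 0"
  proof (cases d)
    case (Inl i)
    have "cmod (level_functional l d (layers l n ?N x) - level_target d x) \<le> 4 / n"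
      unfolding Inl level_target.simps
      by (rule level_functional_layers_Inl[OF x n order_trans[OF r N(1)]])
    also have "\<dots> \<le> 12 / n" by (simp add: divide_right_mono)
    finally show ?thesis .
  next
    case (Inr \<sigma>)
    obtain k where l: "l = k + n" and k: "radial_weight k r \<noteq> 0"
      using w by (auto simp: shifted_weight_def split: if_splits) (metis le_add_diff_inverse2)
    have "real n \<le> 2 ^ n" using of_nat_less_two_power less_imp_le by blast
    have "r + 1 \<le> 3 * 2 ^ k"
    proof -
      have "r \<le> 2 * 2 ^ k" using radial_weight_support[OF k] by simp
      moreover have "(1 :: real) \<le> 2 ^ k" by simp
      ultimately show ?thesis by linarith
    qed
    have "cmod (level_functional l d (layers l n ?N x) - level_target d x)
        \<le> real ?N * 4 / n * (1 / 2) ^ l"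
      unfolding Inr using level_functional_layers_Inr by simp
    also have "\<dots> = real ?N / n * (4 * (1 / 2) ^ l)" by simp
    also have "\<dots> \<le> 3 * 2 ^ k * (4 * (1 / 2) ^ l)"
      using N(2) \<open>r + 1 \<le> 3 * 2 ^ k\<close> by (intro mult_right_mono) auto
    also have "\<dots> = 12 / 2 ^ n" by (simp add: l power_add power_one_over)
    also have "\<dots> \<le> 12 / n" using n \<open>real n \<le> 2 ^ n\<close> by (intro divide_left_mono) auto
    finally show ?thesis .
  qed
  have "shifted_weight n l r * cmod (level_functional l d (layers l n ?N x) - level_target d x)
      \<le> shifted_weight n l r * (12 / n)"
  proof (cases "shifted_weight n l r = 0")
    case False
    then show ?thesis by (intro mult_left_mono bound shifted_weight_nonneg)
  qed simp
  moreover have "level_functional l d (sphere_map n r x) - shifted_weight n l r * level_target d x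
      = shifted_weight n l r * (level_functional l d (layers l n ?N x) - level_target d x)"
    by (simp add: level_functional_sphere_map right_diff_distrib)
  ultimately show ?thesis using shifted_weight_nonneg[of n l r] by (simp add: norm_mult)
qed

definition test_target :: "nat \<Rightarrow> real \<Rightarrow> (nat \<times> (nat + nat list)) list \<Rightarrow> (ell2 \<Rightarrow>\<^sub>L ell2) \<Rightarrow> complex"
  where "test_target n r \<tau> x = (\<Sum>l<length \<tau>.
     phase (fst (\<tau> ! l)) * (shifted_weight n l r * level_target (snd (\<tau> ! l)) x))"

lemma diag_entry_sphere_map_approx:
  assumes "x \<in> c0_space" "1 \<le> n" "\<And>i. cmod (diag_entry x i) \<le> r" and \<tau>: "from_nat t = \<tau>"
  shows "cmod (diag_entry (sphere_map n r x) t - test_target n r \<tau> x) \<le> 12 / n"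
proof -
  have "cmod (diag_entry (sphere_map n r x) t - test_target n r \<tau> x)
      = cmod (\<Sum>l<length \<tau>. phase (fst (\<tau> ! l)) * (level_functional l (snd (\<tau> ! l)) (sphere_map n r x)
          - shifted_weight n l r * level_target (snd (\<tau> ! l)) x))"
    unfolding diag_entry_l1_sum_space[OF sphere_map_in_l1_sum_space \<tau>] test_target_def
    by (simp add: sum_subtractf right_diff_distrib)
  also have "\<dots> \<le> (\<Sum>l<length \<tau>. shifted_weight n l r * (12 / n))"
  proof (rule sum_norm_le)
    fix l
    show "cmod (phase (fst (\<tau> ! l)) * (level_functional l (snd (\<tau> ! l)) (sphere_map n r x)
        - shifted_weight n l r * level_target (snd (\<tau> ! l)) x)) \<le> shifted_weight n l r * (12 / n)"
      unfolding norm_mult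
      by (rule order_trans[OF mult_left_le_one_le[OF norm_ge_zero norm_ge_zero norm_phase_le]])
        (rule level_functional_sphere_map_approx[OF assms(1-3)])
  qed
  also have "\<dots> = (\<Sum>k<length \<tau> - n. radial_weight k r) * (12 / n)"
    by (simp only: sum_distrib_right[symmetric] sum_shifted_weight)
  also have "\<dots> \<le> 1 * (12 / n)" by (intro mult_right_mono sum_radial_weight_le) simp
  finally show ?thesis by simp
qed


section \<open>Matrix estimates\<close>

lemma matrices_over_iff:
  "A \<in> matrices_over n X \<longleftrightarrow> A \<in> carrier_mat n n \<and> (\<forall>i<n. \<forall>j<n. A $$ (i, j) \<in> X)"
proof -
  have "elements_mat A \<subseteq> X \<longleftrightarrow> (\<forall>i<n. \<forall>j<n. A $$ (i, j) \<in> X)" if A: "A \<in> carrier_mat n n"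
  proof
    assume "elements_mat A \<subseteq> X"
    then show "\<forall>i<n. \<forall>j<n. A $$ (i, j) \<in> X" by (meson A elements_matI subsetD)
  next
    assume X: "\<forall>i<n. \<forall>j<n. A $$ (i, j) \<in> X"
    show "elements_mat A \<subseteq> X"
    proof
      fix a assume "a \<in> elements_mat A"
      from elements_matD[OF this] show "a \<in> X" using A X by auto
    qed
  qed
  then show ?thesis by (auto simp: matrices_over_def)
qed

lemma matrix_dist_le_iff:
  assumes A: "A \<in> carrier_mat n n" "\<And>i j. i < n \<Longrightarrow> j < n \<Longrightarrow> is_diag (A $$ (i, j))"
    and B: "B \<in> carrier_mat n n" "\<And>i j. i < n \<Longrightarrow> j < n \<Longrightarrow> is_diag (B $$ (i, j))"
    and c: "0 \<le> c"
  shows "matrix_dist A B \<le> c \<longleftrightarrow>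
    (\<forall>t. mat_bound n (\<lambda>i j. diag_entry (A $$ (i, j)) t - diag_entry (B $$ (i, j)) t) c)"
proof -
  have "matrix_dist A B \<le> c
      \<longleftrightarrow> (\<forall>t. mat_bound n (\<lambda>i j. diag_entry ((A - B) $$ (i, j)) t) c)"
    unfolding matrix_dist_def
    using A B c by (intro matrix_norm_le_iff) (auto simp: is_diag_diff)
  also have "\<dots> \<longleftrightarrow>
      (\<forall>t. mat_bound n (\<lambda>i j. diag_entry (A $$ (i, j)) t - diag_entry (B $$ (i, j)) t) c)"
    using A(1) B(1) by (auto simp: diag_entry_diff elim!: mat_bound_cong)
  finally show ?thesis .
qed

lemma matrix_dist_commute:
  assumes "A \<in> carrier_mat n n" "B \<in> carrier_mat n n"
  shows "matrix_dist A B = matrix_dist B A"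
proof -
  have "norm (\<Sum>j<n. blinfun_apply ((A - B) $$ (i, j)) (x j))
      = norm (\<Sum>j<n. blinfun_apply ((B - A) $$ (i, j)) (x j))" if "i < n" for x :: "nat \<Rightarrow> 'a" and i
  proof -
    have "(\<Sum>j<n. blinfun_apply ((A - B) $$ (i, j)) (x j))
        = - (\<Sum>j<n. blinfun_apply ((B - A) $$ (i, j)) (x j))"
      unfolding sum_negf[symmetric]
      using assms that by (intro sum.cong) (auto simp: minus_blinfun.rep_eq)
    then show ?thesis by (simp only: norm_minus_cancel)
  qed
  then have rows: "L2_set (\<lambda>i. norm (\<Sum>j<n. blinfun_apply ((A - B) $$ (i, j)) (x j))) {..<n}
      = L2_set (\<lambda>i. norm (\<Sum>j<n. blinfun_apply ((B - A) $$ (i, j)) (x j))) {..<n}"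
    for x :: "nat \<Rightarrow> 'a"
    by (intro L2_set_cong refl) simp
  have dims: "dim_row (A - B) = n" "dim_col (A - B) = n" "dim_row (B - A) = n" "dim_col (B - A) = n"
    using assms by auto
  show ?thesis
    unfolding matrix_dist_def matrix_norm_def dims rows ..
qed

lemma matrix_dist_nonneg: "0 \<le> matrix_dist A B"
  by (simp add: matrix_dist_def matrix_norm_nonneg)

definition amplification :: "nat \<Rightarrow> (ell2 \<Rightarrow>\<^sub>L ell2) mat \<Rightarrow> (ell2 \<Rightarrow>\<^sub>L ell2) mat" where
  "amplification n A = map_mat (sphere_map n (matrix_norm A)) A"

lemma amplification_in: "A \<in> matrices_over n c0_space \<Longrightarrow> amplification n A \<in> matrices_over n l1_sum_space"
  by (auto simp: amplification_def matrices_over_iff sphere_map_in_l1_sum_space)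

lemma spherical_amplification_amplification:
  "spherical_amplification n c0_space l1_sum_space (amplification n)"
  unfolding spherical_amplification_def
proof (intro conjI allI impI)
  show "amplification n \<in> matrices_over n c0_space \<rightarrow> matrices_over n l1_sum_space"
    by (auto simp: amplification_in)
  fix r :: real
  show "\<exists>f. f \<in> c0_space \<rightarrow> l1_sum_space \<and>
      (\<forall>A\<in>matrices_over n c0_space. matrix_norm A = r \<longrightarrow> amplification n A = map_mat f A)"
    by (intro exI[of _ "sphere_map n r"]) (auto simp: amplification_def sphere_map_in_l1_sum_space)
qed

context
  fixes n :: nat and A B :: "(ell2 \<Rightarrow>\<^sub>L ell2) mat"
  assumes n: "1 \<le> n" and A: "A \<in> matrices_over n c0_space" and B: "B \<in> matrices_over n c0_space"
begin

lemma mat_bound_c0_matrix: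
  assumes "C \<in> matrices_over n c0_space"
  shows "mat_bound n (\<lambda>i j. diag_entry (C $$ (i, j)) t) (matrix_norm C)"
  using matrix_norm_le_iff[of C n "matrix_norm C"] assms matrix_norm_nonneg
  by (auto simp: matrices_over_iff is_diag_c0_space)

lemma mat_bound_c0_dist:
  "mat_bound n (\<lambda>i j. diag_entry (A $$ (i, j)) t - diag_entry (B $$ (i, j)) t) (matrix_dist A B)"
  using matrix_dist_le_iff[of A n B "matrix_dist A B"] A B matrix_dist_nonneg
  by (auto simp: matrices_over_iff is_diag_c0_space)

lemma matrix_norm_diff_le: "matrix_norm A - matrix_norm B \<le> matrix_dist A B"
proof -
  have "matrix_norm A \<le> matrix_dist A B + matrix_norm B"
  proof (subst matrix_norm_le_iff)
    show "\<forall>t. mat_bound n (\<lambda>i j. diag_entry (A $$ (i, j)) t) (matrix_dist A B + matrix_norm B)"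
    proof
      fix t
      show "mat_bound n (\<lambda>i j. diag_entry (A $$ (i, j)) t) (matrix_dist A B + matrix_norm B)"
        using mat_bound_add[OF mat_bound_c0_dist[of t] mat_bound_c0_matrix[OF B, of t]] by simp
    qed
  qed (use A matrix_dist_nonneg matrix_norm_nonneg in
      \<open>auto simp: matrices_over_iff is_diag_c0_space intro!: add_nonneg_nonneg\<close>)
  then show ?thesis by simp
qed

lemma amplification_approx:
  assumes C: "C \<in> matrices_over n c0_space" and ij: "i < n" "j < n" and \<tau>: "from_nat t = \<tau>"
  shows "cmod (diag_entry (amplification n C $$ (i, j)) t
    - test_target n (matrix_norm C) \<tau> (C $$ (i, j))) \<le> 12 / n"
proof -
  have "C \<in> carrier_mat n n" and c0: "C $$ (i, j) \<in> c0_space"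
    using C ij by (auto simp: matrices_over_iff)
  then have entry: "amplification n C $$ (i, j) = sphere_map n (matrix_norm C) (C $$ (i, j))"
    using ij by (simp add: amplification_def)
  show ?thesis
    unfolding entry
    by (rule diag_entry_sphere_map_approx[OF c0 n mat_bound_entry_le[OF mat_bound_c0_matrix[OF C] ij] \<tau>])
qed

lemma mat_bound_amplification_error:
  assumes \<tau>: "from_nat t = \<tau>"
  shows "mat_bound n (\<lambda>i j.
      (diag_entry (amplification n A $$ (i, j)) t - test_target n (matrix_norm A) \<tau> (A $$ (i, j)))
      - (diag_entry (amplification n B $$ (i, j)) t - test_target n (matrix_norm B) \<tau> (B $$ (i, j)))) 24"
proof -
  have "mat_bound n (\<lambda>i j.
      (diag_entry (amplification n A $$ (i, j)) t - test_target n (matrix_norm A) \<tau> (A $$ (i, j)))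
      - (diag_entry (amplification n B $$ (i, j)) t - test_target n (matrix_norm B) \<tau> (B $$ (i, j))))
      (n * (24 / n))"
  proof (rule mat_bound_entries)
    fix i j assume "i < n" "j < n"
    then show "cmod ((diag_entry (amplification n A $$ (i, j)) t
          - test_target n (matrix_norm A) \<tau> (A $$ (i, j)))
        - (diag_entry (amplification n B $$ (i, j)) t
          - test_target n (matrix_norm B) \<tau> (B $$ (i, j)))) \<le> 24 / n"
      using order_trans[OF norm_triangle_ineq4 add_mono[OF amplification_approx[OF A _ _ \<tau>]
            amplification_approx[OF B _ _ \<tau>]]]
      by simp
  qed simp
  then show ?thesis using n by simp
qed

text \<open>
  The linear main terms. Replacing \<open>A\<close> by \<open>B\<close> under the weights of \<open>A\<close> costs \<open>matrix_dist A B\<close>, since the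
  weights add up to at most \<open>1\<close>; changing the weights costs four times the difference of the norms.
\<close>

lemma mat_bound_test_target:
  assumes le: "matrix_norm B \<le> matrix_norm A"
  shows "mat_bound n (\<lambda>i j. test_target n (matrix_norm A) \<tau> (A $$ (i, j))
    - test_target n (matrix_norm B) \<tau> (B $$ (i, j))) (5 * matrix_dist A B)"
proof -
  let ?r = "matrix_norm A" and ?s = "matrix_norm B" and ?\<delta> = "matrix_dist A B"
  let ?m = "\<lambda>l. phase (fst (\<tau> ! l))" and ?d = "\<lambda>l. snd (\<tau> ! l)"
  have tdiff: "mat_bound n (\<lambda>i j. level_target d (A $$ (i, j)) - level_target d (B $$ (i, j))) ?\<delta>" for d
    using mat_bound_c0_dist mat_bound_mono[OF mat_bound_0 matrix_dist_nonneg]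
    by (cases d) auto
  have tB: "mat_bound n (\<lambda>i j. level_target d (B $$ (i, j))) ?s" for d
    using mat_bound_c0_matrix[OF B] mat_bound_mono[OF mat_bound_0 matrix_norm_nonneg]
    by (cases d) auto
  have scaled: "mat_bound n (\<lambda>i j. phase m * (complex_of_real w * a i j)) (\<bar>w\<bar> * c)"
    if "mat_bound n a c" "0 \<le> c" for m w a c
  proof (rule mat_bound_mono[OF mat_bound_scale[OF mat_bound_scale[OF that(1)]]])
    show "cmod (phase m) * (cmod (complex_of_real w) * c) \<le> \<bar>w\<bar> * c"
      using norm_phase_le that(2) by (simp add: mult_left_le_one_le)
  qed
  have "mat_bound n (\<lambda>i j.
      (\<Sum>l<length \<tau>. ?m l * (complex_of_real (shifted_weight n l ?r)
        * (level_target (?d l) (A $$ (i, j)) - level_target (?d l) (B $$ (i, j)))))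
      + (\<Sum>l<length \<tau>. ?m l * (complex_of_real (shifted_weight n l ?r - shifted_weight n l ?s)
        * level_target (?d l) (B $$ (i, j)))))
      ((\<Sum>l<length \<tau>. \<bar>shifted_weight n l ?r\<bar> * ?\<delta>)
      + (\<Sum>l<length \<tau>. \<bar>shifted_weight n l ?r - shifted_weight n l ?s\<bar> * ?s))"
    by (intro mat_bound_add mat_bound_sum scaled tdiff tB matrix_dist_nonneg matrix_norm_nonneg)
  then have "mat_bound n (\<lambda>i j. test_target n ?r \<tau> (A $$ (i, j)) - test_target n ?s \<tau> (B $$ (i, j)))
      ((\<Sum>l<length \<tau>. \<bar>shifted_weight n l ?r\<bar> * ?\<delta>)
      + (\<Sum>l<length \<tau>. \<bar>shifted_weight n l ?r - shifted_weight n l ?s\<bar> * ?s))"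
  proof (rule mat_bound_cong)
    fix i j
    show "test_target n ?r \<tau> (A $$ (i, j)) - test_target n ?s \<tau> (B $$ (i, j))
      = (\<Sum>l<length \<tau>. ?m l * (complex_of_real (shifted_weight n l ?r)
        * (level_target (?d l) (A $$ (i, j)) - level_target (?d l) (B $$ (i, j)))))
      + (\<Sum>l<length \<tau>. ?m l * (complex_of_real (shifted_weight n l ?r - shifted_weight n l ?s)
        * level_target (?d l) (B $$ (i, j))))"
      unfolding test_target_def sum.distrib[symmetric] sum_subtractf[symmetric]
      by (rule sum.cong) (simp_all add: algebra_simps)
  qed
  then show ?thesis
  proof (rule mat_bound_mono)
    have "(\<Sum>l<length \<tau>. \<bar>shifted_weight n l ?r\<bar> * ?\<delta>)
        = (\<Sum>k<length \<tau> - n. radial_weight k ?r) * ?\<delta>"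
      by (simp only: sum_distrib_right[symmetric] abs_of_nonneg[OF shifted_weight_nonneg]
          sum_shifted_weight)
    also have "\<dots> \<le> 1 * ?\<delta>" by (intro mult_right_mono sum_radial_weight_le matrix_dist_nonneg)
    finally have fixed_weights: "(\<Sum>l<length \<tau>. \<bar>shifted_weight n l ?r\<bar> * ?\<delta>) \<le> ?\<delta>" by simp
    have "(\<Sum>l<length \<tau>. \<bar>shifted_weight n l ?r - shifted_weight n l ?s\<bar> * ?s) \<le> 4 * (?r - ?s)"
      by (rule shifted_weight_variation[OF matrix_norm_nonneg le])
    also have "\<dots> \<le> 4 * ?\<delta>" using matrix_norm_diff_le by simp
    finally show "(\<Sum>l<length \<tau>. \<bar>shifted_weight n l ?r\<bar> * ?\<delta>)
      + (\<Sum>l<length \<tau>. \<bar>shifted_weight n l ?r - shifted_weight n l ?s\<bar> * ?s) \<le> 5 * ?\<delta>"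
      using add_mono[OF fixed_weights] by fastforce
  qed
qed

lemma amplification_carrier:
  assumes "C \<in> matrices_over n c0_space"
  shows "amplification n C \<in> carrier_mat n n"
    and "i < n \<Longrightarrow> j < n \<Longrightarrow> is_diag (amplification n C $$ (i, j))"
  using amplification_in[OF assms] by (auto simp: matrices_over_iff is_diag_l1_sum_space)

lemma amplification_dist_le_ordered:
  assumes "matrix_norm B \<le> matrix_norm A"
  shows "matrix_dist (amplification n A) (amplification n B) \<le> 5 * matrix_dist A B + 24"
proof (subst matrix_dist_le_iff)
  show "\<forall>t. mat_bound n (\<lambda>i j. diag_entry (amplification n A $$ (i, j)) t
      - diag_entry (amplification n B $$ (i, j)) t) (5 * matrix_dist A B + 24)"
  proof
    fix t
    show "mat_bound n (\<lambda>i j. diag_entry (amplification n A $$ (i, j)) t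
        - diag_entry (amplification n B $$ (i, j)) t) (5 * matrix_dist A B + 24)"
      using mat_bound_add[OF mat_bound_test_target[OF assms, of "from_nat t"]
          mat_bound_amplification_error[of t, OF refl]]
      by (rule mat_bound_cong) simp
  qed
qed (use amplification_carrier[OF A] amplification_carrier[OF B] matrix_dist_nonneg[of A B] in auto)

text \<open>
  The test that adds the \<open>i\<close>-th coordinates of all quotients returns the \<open>i\<close>-th entry: on sufficiently
  many levels the weights add up to \<open>1\<close>.
\<close>

lemma test_target_constant:
  assumes r: "r \<le> 2 ^ K"
  shows "test_target n r (replicate (Suc K + n) (1, Inl i)) x = diag_entry x i"
proof -
  have "test_target n r (replicate L (1, Inl i)) x
      = (\<Sum>l<L. complex_of_real (shifted_weight n l r)) * diag_entry x i" for L
    unfolding test_target_def sum_distrib_right by (intro sum.cong) auto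
  also have "(\<Sum>l<Suc K + n. complex_of_real (shifted_weight n l r))
      = complex_of_real (\<Sum>k<Suc K. radial_weight k r)"
    by (simp only: of_real_sum[symmetric] sum_shifted_weight add_diff_cancel_right')
  also have "(\<Sum>k<Suc K. radial_weight k r) = 1"
    unfolding sum_radial_weight by (simp add: ramp_eq_0[OF r])
  finally show ?thesis by simp
qed

text \<open>
  Summing the quotient maps over all levels is a bounded linear left inverse of the construction up
  to bounded error. The coordinates of its partial sums are tests, so it does not increase matrix
  norms.
\<close>

lemma dist_le_amplification_dist:
  "matrix_dist A B \<le> matrix_dist (amplification n A) (amplification n B) + 24"
proof (subst matrix_dist_le_iff)
  let ?FA = "amplification n A" and ?FB = "amplification n B"
  show "\<forall>i0. mat_bound n (\<lambda>i j. diag_entry (A $$ (i, j)) i0 - diag_entry (B $$ (i, j)) i0)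
      (matrix_dist ?FA ?FB + 24)"
  proof
    fix i0
    let ?R = "max (matrix_norm A) (matrix_norm B)"
    define K where "K = nat \<lceil>?R\<rceil>"
    define \<tau> :: "(nat \<times> (nat + nat list)) list" where "\<tau> = replicate (Suc K + n) (1, Inl i0)"
    have "?R \<le> 2 ^ K" unfolding K_def by (rule le_two_power_ceiling)
    then have target: "test_target n (matrix_norm A) \<tau> x = diag_entry x i0"
      "test_target n (matrix_norm B) \<tau> x = diag_entry x i0" for x
      unfolding \<tau>_def by (intro test_target_constant; simp)+
    have "mat_bound n (\<lambda>i j. diag_entry (?FA $$ (i, j)) (to_nat \<tau>)
        - diag_entry (?FB $$ (i, j)) (to_nat \<tau>)) (matrix_dist ?FA ?FB)"
      using matrix_dist_le_iff[of ?FA n ?FB "matrix_dist ?FA ?FB"] amplification_carrier[OF A]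
        amplification_carrier[OF B] matrix_dist_nonneg by blast
    from mat_bound_add[OF this mat_bound_scale[OF mat_bound_amplification_error[OF from_nat_to_nat],
        of "-1" \<tau>]]
    have "mat_bound n (\<lambda>i j. diag_entry (A $$ (i, j)) i0 - diag_entry (B $$ (i, j)) i0)
        (matrix_dist ?FA ?FB + cmod (- 1) * 24)"
      by (rule mat_bound_cong) (simp add: target)
    then show "mat_bound n (\<lambda>i j. diag_entry (A $$ (i, j)) i0 - diag_entry (B $$ (i, j)) i0)
        (matrix_dist ?FA ?FB + 24)" by simp
  qed
qed (use A B matrix_dist_nonneg in
    \<open>auto simp: matrices_over_iff is_diag_c0_space intro!: add_nonneg_nonneg\<close>)

end

lemma amplification_dist_le:
  assumes n: "1 \<le> n" and A: "A \<in> matrices_over n c0_space" and B: "B \<in> matrices_over n c0_space"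
  shows "matrix_dist (amplification n A) (amplification n B) \<le> 5 * matrix_dist A B + 24"
proof (cases "matrix_norm B \<le> matrix_norm A")
  case True
  then show ?thesis by (rule amplification_dist_le_ordered[OF n A B])
next
  case False
  then have "matrix_norm A \<le> matrix_norm B" by simp
  from amplification_dist_le_ordered[OF n B A this] show ?thesis
    using matrix_dist_commute[of A n B] matrix_dist_commute[of "amplification n A" n "amplification n B"]
      A B amplification_in[OF A] amplification_in[OF B]
    by (simp add: matrices_over_iff)
qed

lemma c0_space_spherically_completely_coarsely_embeds:
  "spherically_completely_coarsely_embeds c0_space l1_sum_space"
  unfolding spherically_completely_coarsely_embeds_def equi_coarse_embedding_def
proof (intro exI[of _ amplification] conjI allI impI)
  show "spherical_amplification n c0_space l1_sum_space (amplification n)" for n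
    by (rule spherical_amplification_amplification)
next
  fix t :: real
  have "equi_omega (\<lambda>n. matrices_over n c0_space) (\<lambda>_. matrix_dist) (\<lambda>_. matrix_dist) amplification t
      \<le> ereal (5 * t + 24)"
    unfolding equi_omega_def
    by (intro SUP_least) (auto intro!: order_trans[OF amplification_dist_le])
  then show "equi_omega (\<lambda>n. matrices_over n c0_space) (\<lambda>_. matrix_dist) (\<lambda>_. matrix_dist) amplification t
      < \<infinity>"
    by (rule le_less_trans) simp
next
  have rho: "ereal (t - 24)
      \<le> equi_rho (\<lambda>n. matrices_over n c0_space) (\<lambda>_. matrix_dist) (\<lambda>_. matrix_dist) amplification t"
    for t
    unfolding equi_rho_def
  proof (intro INF_greatest)
    fix n p assume "n \<in> {1 :: nat..}"
      and "p \<in> {(x, y). x \<in> matrices_over n c0_space \<and> y \<in> matrices_over n c0_space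
        \<and> t \<le> matrix_dist x y}"
    then show "ereal (t - 24) \<le> (case p of (x, y) \<Rightarrow>
        ereal (matrix_dist (amplification n x) (amplification n y)))"
      using dist_le_amplification_dist[of n] by fastforce
  qed
  show "(equi_rho (\<lambda>n. matrices_over n c0_space) (\<lambda>_. matrix_dist) (\<lambda>_. matrix_dist) amplification
      \<longlongrightarrow> \<infinity>) at_top"
    unfolding tendsto_PInfty
  proof
    fix c :: real
    show "\<forall>\<^sub>F t in at_top. ereal c < equi_rho (\<lambda>n. matrices_over n c0_space) (\<lambda>_. matrix_dist)
        (\<lambda>_. matrix_dist) amplification t"
    proof (rule eventually_mono[OF eventually_gt_at_top[of "c + 24"]])
      fix t assume "c + 24 < t"
      then have "ereal c < ereal (t - 24)" by simp
      then show "ereal c < equi_rho (\<lambda>n. matrices_over n c0_space) (\<lambda>_. matrix_dist)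
        (\<lambda>_. matrix_dist) amplification t"
        using rho by (rule less_le_trans)
    qed
  qed
qed

text \<open>
  The witnesses are \<open>c\<^sub>0\<close> and, up to an equivalent norm, an \<open>\<ell>\<^sub>1\<close>-sum of renormings of \<open>\<ell>\<^sub>1\<close>, both
  with their minimal operator space structure.
\<close>

theorem theorem1p11:
  shows "\<exists>(X :: (ell2 \<Rightarrow>\<^sub>L ell2) set) (Y :: (ell2 \<Rightarrow>\<^sub>L ell2) set).
    separable_operator_space X \<and> separable_operator_space Y \<and>
    \<not> isomorphically_embeds X Y \<and>
    spherically_completely_coarsely_embeds X Y"
proof (intro exI conjI)
  show "separable_operator_space c0_space"
    unfolding c0_space_def
    by (intro separable_operator_space_gen_space is_diag_complex_operator is_diag_c0_gen)
  show "separable_operator_space l1_sum_space"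
    unfolding l1_sum_space_def
    by (intro separable_operator_space_gen_space is_diag_complex_operator is_diag_l1_gen)
  show "\<not> isomorphically_embeds c0_space l1_sum_space" by (rule c0_space_not_embeds)
  show "spherically_completely_coarsely_embeds c0_space l1_sum_space"
    by (rule c0_space_spherically_completely_coarsely_embeds)
qed

end
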